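(* Let $T\in\mathcal F$ be a trigraph with no balanced skew-partition and let $X$ be a fragment of $T$ (in the sense including homogeneous pairs). Then the block of decomposition $T_X$ belongs to $\mathcal F$.
   Context: Trigraphs: finite $V(T)$ with $\theta:\binom{V(T)}{2}\to\{-1,0,1\}$; $u,v$ strongly adjacent if $\theta(uv)=1$, strongly antiadjacent if $-1$, a switchable pair if $0$; adjacent (neighbours) if $\theta\in\{0,1\}$, antiadjacent (antineighbours) if $\theta\in\{-1,0\}$. Complement $\overline T$: $-\theta$; $T|X$: induced trigraph. Strongly complete/anticomplete: strongly adjacent/antiadjacent to every vertex of a set. Full realization: graph on $V(T)$ of adjacent pairs. $X$ connected: full realization of $T|X$ connected; anticonnected: complement of graph on $X$ of strongly adjacent pairs connected; components = maximal connected subsets. Path: distinct $p_1,\dots,p_k$, consecutive adjacent, non-consecutive antiadjacent (length $k-1$, interior = inner vertices). Hole: $h_1,\dots,h_k$, $k\ge4$, $h_i,h_j$ adjacent iff $|i-j|\in\{1,k-1\}$, else antiadjacent. Antipath/antihole: complement is a path/hole in $\overline T$. Berge: no odd hole, no odd antihole. Skew-partition: partition $(A,B)$ of $V(T)$, $A$ not connected, $B$ not anticonnected; balanced if no path of odd length $>1$ with ends in $B$ and interior in $A$ and no antipath of odd length $>1$ with ends in $A$ and interior in $B$. $\mathcal F$: Berge trigraphs such that each component of the graph $\Sigma(T)$ of switchable pairs has at most two edges and each vertex $v$ of $\Sigma(T)$-degree two with $\Sigma(T)$-neighbours $x,y$ is either strongly complete to $V(T)\setminus\{v,x,y\}$ with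 $x,y$ strongly adjacent, or strongly anticomplete to $V(T)\setminus\{v,x,y\}$ with $x,y$ strongly antiadjacent. $2$-join: partition $(X_1,X_2)$ with disjoint $A_1,B_1,C_1,A_2,B_2,C_2$ (split), $X_i=A_i\cup B_i\cup C_i$, $A_i,B_i\neq\emptyset$, no switchable pair between $X_1,X_2$, $A_1$ strongly complete to $A_2$, $B_1$ strongly complete to $B_2$, all other pairs between $X_1,X_2$ strongly antiadjacent, $|X_i|\ge3$, and if $|A_i|=|B_i|=1$ the full realization of $T|X_i$ is not a path of length two between the vertices of $A_i$ and $B_i$; proper if each component of $T|X_i$ meets $A_i$ and $B_i$. (Proper) complement $2$-join: (proper) $2$-join of $\overline T$, same split. In a Berge trigraph, for a proper $2$-join all paths from $A_i$ to $B_i$ with interior in $C_i$ ($i=1,2$) have the same length parity, called odd/even accordingly; complement $2$-joins have the parity of the $2$-join of $\overline T$. Proper homogeneous pair: disjoint nonempty $A,B\subseteq V(T)$ such that, letting $A_1$ ($A_2$) be the set of vertices of $V(T)\setminus(A\cup B)$ strongly complete (strongly anticomplete) to $A$ and $B_1,B_2$ likewise for $B$: $|A|>1$, $|B|>1$; $A_1\cup A_2=B_1\cup B_2=V(T)\setminus(A\cup B)$; every vertex of $A$ has a neighbour and an antineighbour in $B$ and vice versa; and $A_1\cap B_1$, $A_1\cap B_2$, $A_2\cap B_1$, $A_2\cap B_2$ are nonempty. Its split is $(A,B,C,D,E,F)$ with $C=A_1\cap B_2$, $D=A_2\cap B_1$, $E=A_1\cap B_1$, $F=A_2\cap B_2$.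 Fragment: $X\subseteq V(T)$ such that $(X,V(T)\setminus X)$ is a proper $2$-join or a proper complement $2$-join of $T$, or $X=A\cup B$ or $X=V(T)\setminus(A\cup B)$ for a proper homogeneous pair $(A,B)$. Blocks $T_X$, adding new marker vertices with all unspecified new pairs strongly antiadjacent. For $X=X_1$ of a $2$-join with split $(A_1,B_1,C_1,A_2,B_2,C_2)$, start from $T|X_1$: odd $2$-join: add $a,b$, $a$ strongly complete to $A_1$, $b$ strongly complete to $B_1$, $ab$ switchable; even $2$-join: add $a,b,c$, $a$ strongly complete to $A_1$, $b$ strongly complete to $B_1$, $ac,cb$ switchable; odd complement $2$-join: add $a,b$, $a$ strongly complete to $B_1\cup C_1$, $b$ strongly complete to $A_1\cup C_1$, $ab$ switchable; even complement $2$-join: add $a,b,c$, $a$ strongly complete to $B_1\cup C_1$, $b$ strongly complete to $A_1\cup C_1$, $c$ strongly complete to $X_1$, $ac,cb$ switchable, $ab$ strongly adjacent. For $X=A\cup B$: start from $T|(A\cup B)$, add $c$ strongly complete to $A$ and $d$ strongly complete to $B$ with $cd$ switchable. For $X=C\cup D\cup E\cup F$: start from $T|X$, add $a$ strongly complete to $C\cup E$ and $b$ strongly complete to $D\cup E$ with $ab$ switchable. *)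

theory Defs
  imports Main
begin

section \<open>Trigraphs\<close>

text \<open>
  The function on unordered pairs of vertices is encoded as a binary function that is symmetric
  on distinct vertices; its values outside distinct pairs of vertices are irrelevant.
\<close>

record 'a trigraph =
  verts :: "'a set"
  theta :: "'a \<Rightarrow> 'a \<Rightarrow> int"

definition trigraph :: "'a trigraph \<Rightarrow> bool" where
  "trigraph T \<longleftrightarrow> finite (verts T) \<and>
     (\<forall>u\<in>verts T. \<forall>v\<in>verts T. u \<noteq> v \<longrightarrow>
        theta T u v \<in> {-1, 0, 1} \<and> theta T u v = theta T v u)"

definition strong_adj :: "'a trigraph \<Rightarrow> 'a \<Rightarrow> 'a \<Rightarrow> bool" where
  "strong_adj T u v \<longleftrightarrow> u \<in> verts T \<and> v \<in> verts T \<and> u \<noteq> v \<and> theta T u v = 1"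

definition strong_antiadj :: "'a trigraph \<Rightarrow> 'a \<Rightarrow> 'a \<Rightarrow> bool" where
  "strong_antiadj T u v \<longleftrightarrow> u \<in> verts T \<and> v \<in> verts T \<and> u \<noteq> v \<and> theta T u v = -1"

definition switchable :: "'a trigraph \<Rightarrow> 'a \<Rightarrow> 'a \<Rightarrow> bool" where
  "switchable T u v \<longleftrightarrow> u \<in> verts T \<and> v \<in> verts T \<and> u \<noteq> v \<and> theta T u v = 0"

definition adj :: "'a trigraph \<Rightarrow> 'a \<Rightarrow> 'a \<Rightarrow> bool" where
  "adj T u v \<longleftrightarrow> u \<in> verts T \<and> v \<in> verts T \<and> u \<noteq> v \<and> theta T u v \<in> {0, 1}"

definition antiadj :: "'a trigraph \<Rightarrow> 'a \<Rightarrow> 'a \<Rightarrow> bool" where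
  "antiadj T u v \<longleftrightarrow> u \<in> verts T \<and> v \<in> verts T \<and> u \<noteq> v \<and> theta T u v \<in> {-1, 0}"

definition complement :: "'a trigraph \<Rightarrow> 'a trigraph" where
  "complement T = \<lparr>verts = verts T, theta = (\<lambda>u v. - theta T u v)\<rparr>"

definition induced :: "'a trigraph \<Rightarrow> 'a set \<Rightarrow> 'a trigraph" where
  "induced T X = \<lparr>verts = X, theta = theta T\<rparr>"

definition strongly_complete :: "'a trigraph \<Rightarrow> 'a \<Rightarrow> 'a set \<Rightarrow> bool" where
  "strongly_complete T v S \<longleftrightarrow> (\<forall>s\<in>S. strong_adj T v s)"

definition strongly_anticomplete :: "'a trigraph \<Rightarrow> 'a \<Rightarrow> 'a set \<Rightarrow> bool" where
  "strongly_anticomplete T v S \<longleftrightarrow> (\<forall>s\<in>S. strong_antiadj T v s)"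


section \<open>Connectivity\<close>

text \<open>A graph is given by its vertex set and its set of two-element edges.\<close>

definition graph_connected :: "'a set \<Rightarrow> 'a set set \<Rightarrow> bool" where
  "graph_connected V E \<longleftrightarrow> (\<forall>u\<in>V. \<forall>v\<in>V. (u, v) \<in> {(x, y). {x, y} \<in> E}\<^sup>*)"

definition graph_compl :: "'a set \<Rightarrow> 'a set set \<Rightarrow> 'a set set" where
  "graph_compl V E = {{u, v} |u v. u \<in> V \<and> v \<in> V \<and> u \<noteq> v \<and> {u, v} \<notin> E}"

definition full_realization :: "'a trigraph \<Rightarrow> 'a set set" where
  "full_realization T = {{u, v} |u v. adj T u v}"

definition strong_edges :: "'a trigraph \<Rightarrow> 'a set set" where
  "strong_edges T = {{u, v} |u v. strong_adj T u v}"

definition switchable_edges :: "'a trigraph \<Rightarrow> 'a set set" where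
  "switchable_edges T = {{u, v} |u v. switchable T u v}"

definition tri_connected :: "'a trigraph \<Rightarrow> 'a set \<Rightarrow> bool" where
  "tri_connected T X \<longleftrightarrow> graph_connected X (full_realization (induced T X))"

definition tri_anticonnected :: "'a trigraph \<Rightarrow> 'a set \<Rightarrow> bool" where
  "tri_anticonnected T X \<longleftrightarrow> graph_connected X (graph_compl X (strong_edges (induced T X)))"

definition tri_component :: "'a trigraph \<Rightarrow> 'a set \<Rightarrow> bool" where
  "tri_component T Y \<longleftrightarrow> Y \<noteq> {} \<and> Y \<subseteq> verts T \<and> tri_connected T Y \<and>
     (\<forall>Z. Y \<subseteq> Z \<and> Z \<subseteq> verts T \<and> tri_connected T Z \<longrightarrow> Z = Y)"

definition graph_component :: "'a set \<Rightarrow> 'a set set \<Rightarrow> 'a set \<Rightarrow> bool" where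
  "graph_component V E Y \<longleftrightarrow> Y \<noteq> {} \<and> Y \<subseteq> V \<and> graph_connected Y {e\<in>E. e \<subseteq> Y} \<and>
     (\<forall>Z. Y \<subseteq> Z \<and> Z \<subseteq> V \<and> graph_connected Z {e\<in>E. e \<subseteq> Z} \<longrightarrow> Z = Y)"


section \<open>Paths, holes, Berge trigraphs, skew-partitions\<close>

definition is_path :: "'a trigraph \<Rightarrow> 'a list \<Rightarrow> bool" where
  "is_path T p \<longleftrightarrow> p \<noteq> [] \<and> distinct p \<and> set p \<subseteq> verts T \<and>
     (\<forall>i j. i < j \<and> j < length p \<longrightarrow>
        (if j = i + 1 then adj T (p ! i) (p ! j) else antiadj T (p ! i) (p ! j)))"

definition path_length :: "'a list \<Rightarrow> nat" where
  "path_length p = length p - 1"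

definition interior :: "'a list \<Rightarrow> 'a set" where
  "interior p = set (butlast (tl p))"

definition is_antipath :: "'a trigraph \<Rightarrow> 'a list \<Rightarrow> bool" where
  "is_antipath T p \<longleftrightarrow> is_path (complement T) p"

definition is_hole :: "'a trigraph \<Rightarrow> 'a list \<Rightarrow> bool" where
  "is_hole T h \<longleftrightarrow> length h \<ge> 4 \<and> distinct h \<and> set h \<subseteq> verts T \<and>
     (\<forall>i j. i < j \<and> j < length h \<longrightarrow>
        (if j - i \<in> {1, length h - 1} then adj T (h ! i) (h ! j) else antiadj T (h ! i) (h ! j)))"

definition is_antihole :: "'a trigraph \<Rightarrow> 'a list \<Rightarrow> bool" where
  "is_antihole T h \<longleftrightarrow> is_hole (complement T) h"

definition berge :: "'a trigraph \<Rightarrow> bool" where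
  "berge T \<longleftrightarrow> (\<nexists>h. is_hole T h \<and> odd (length h)) \<and> (\<nexists>h. is_antihole T h \<and> odd (length h))"

definition skew_partition :: "'a trigraph \<Rightarrow> 'a set \<Rightarrow> 'a set \<Rightarrow> bool" where
  "skew_partition T A B \<longleftrightarrow> A \<union> B = verts T \<and> A \<inter> B = {} \<and>
     \<not> tri_connected T A \<and> \<not> tri_anticonnected T B"

definition balanced_skew_partition :: "'a trigraph \<Rightarrow> 'a set \<Rightarrow> 'a set \<Rightarrow> bool" where
  "balanced_skew_partition T A B \<longleftrightarrow> skew_partition T A B \<and>
     (\<nexists>p. is_path T p \<and> odd (path_length p) \<and> path_length p > 1 \<and>
          hd p \<in> B \<and> last p \<in> B \<and> interior p \<subseteq> A) \<and>
     (\<nexists>p. is_antipath T p \<and> odd (path_length p) \<and> path_length p > 1 \<and>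
          hd p \<in> A \<and> last p \<in> A \<and> interior p \<subseteq> B)"


section \<open>The class F\<close>

definition class_F :: "'a trigraph set" where
  "class_F = {T. trigraph T \<and> berge T \<and>
     (\<forall>Y. graph_component (verts T) (switchable_edges T) Y \<longrightarrow>
        card {e\<in>switchable_edges T. e \<subseteq> Y} \<le> 2) \<and>
     (\<forall>v x y. v \<in> verts T \<and> x \<noteq> y \<and> {w. switchable T v w} = {x, y} \<longrightarrow>
        (strongly_complete T v (verts T - {v, x, y}) \<and> strong_adj T x y) \<or>
        (strongly_anticomplete T v (verts T - {v, x, y}) \<and> strong_antiadj T x y))}"


section \<open>2-joins\<close>

definition pairwise_disjoint6 ::
  "'a set \<Rightarrow> 'a set \<Rightarrow> 'a set \<Rightarrow> 'a set \<Rightarrow> 'a set \<Rightarrow> 'a set \<Rightarrow> bool" where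
  "pairwise_disjoint6 A1 B1 C1 A2 B2 C2 \<longleftrightarrow>
     A1 \<inter> B1 = {} \<and> A1 \<inter> C1 = {} \<and> A1 \<inter> A2 = {} \<and> A1 \<inter> B2 = {} \<and> A1 \<inter> C2 = {} \<and>
     B1 \<inter> C1 = {} \<and> B1 \<inter> A2 = {} \<and> B1 \<inter> B2 = {} \<and> B1 \<inter> C2 = {} \<and>
     C1 \<inter> A2 = {} \<and> C1 \<inter> B2 = {} \<and> C1 \<inter> C2 = {} \<and>
     A2 \<inter> B2 = {} \<and> A2 \<inter> C2 = {} \<and> B2 \<inter> C2 = {}"

text \<open>
  The side with parts A, B, C consists of at least three vertices, and its full realization is not
  a path of length two joining the unique vertex of A to the unique vertex of B.
\<close>

definition two_join_side :: "'a trigraph \<Rightarrow> 'a set \<Rightarrow> 'a set \<Rightarrow> 'a set \<Rightarrow> bool" where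
  "two_join_side T A B C \<longleftrightarrow> A \<noteq> {} \<and> B \<noteq> {} \<and> card (A \<union> B \<union> C) \<ge> 3 \<and>
     \<not> (\<exists>a b c. A = {a} \<and> B = {b} \<and> distinct [a, c, b] \<and> A \<union> B \<union> C = {a, c, b} \<and>
          full_realization (induced T (A \<union> B \<union> C)) = {{a, c}, {c, b}})"

definition two_join ::
  "'a trigraph \<Rightarrow> 'a set \<Rightarrow> 'a set \<Rightarrow> 'a set \<Rightarrow> 'a set \<Rightarrow> 'a set \<Rightarrow> 'a set \<Rightarrow> bool" where
  "two_join T A1 B1 C1 A2 B2 C2 \<longleftrightarrow>
     pairwise_disjoint6 A1 B1 C1 A2 B2 C2 \<and>
     verts T = (A1 \<union> B1 \<union> C1) \<union> (A2 \<union> B2 \<union> C2) \<and>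
     (\<forall>u\<in>A1 \<union> B1 \<union> C1. \<forall>v\<in>A2 \<union> B2 \<union> C2. \<not> switchable T u v) \<and>
     (\<forall>u\<in>A1. strongly_complete T u A2) \<and>
     (\<forall>u\<in>B1. strongly_complete T u B2) \<and>
     (\<forall>u\<in>A1 \<union> B1 \<union> C1. \<forall>v\<in>A2 \<union> B2 \<union> C2.
        \<not> (u \<in> A1 \<and> v \<in> A2) \<and> \<not> (u \<in> B1 \<and> v \<in> B2) \<longrightarrow> strong_antiadj T u v) \<and>
     two_join_side T A1 B1 C1 \<and> two_join_side T A2 B2 C2"

definition proper_two_join ::
  "'a trigraph \<Rightarrow> 'a set \<Rightarrow> 'a set \<Rightarrow> 'a set \<Rightarrow> 'a set \<Rightarrow> 'a set \<Rightarrow> 'a set \<Rightarrow> bool" where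
  "proper_two_join T A1 B1 C1 A2 B2 C2 \<longleftrightarrow>
     two_join T A1 B1 C1 A2 B2 C2 \<and>
     (\<forall>Y. tri_component (induced T (A1 \<union> B1 \<union> C1)) Y \<longrightarrow> Y \<inter> A1 \<noteq> {} \<and> Y \<inter> B1 \<noteq> {}) \<and>
     (\<forall>Y. tri_component (induced T (A2 \<union> B2 \<union> C2)) Y \<longrightarrow> Y \<inter> A2 \<noteq> {} \<and> Y \<inter> B2 \<noteq> {})"

definition proper_complement_two_join ::
  "'a trigraph \<Rightarrow> 'a set \<Rightarrow> 'a set \<Rightarrow> 'a set \<Rightarrow> 'a set \<Rightarrow> 'a set \<Rightarrow> 'a set \<Rightarrow> bool" where
  "proper_complement_two_join T A1 B1 C1 A2 B2 C2 \<longleftrightarrow>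
     proper_two_join (complement T) A1 B1 C1 A2 B2 C2"

definition side_path :: "'a trigraph \<Rightarrow> 'a set \<Rightarrow> 'a set \<Rightarrow> 'a set \<Rightarrow> 'a list \<Rightarrow> bool" where
  "side_path T A B C p \<longleftrightarrow> is_path T p \<and> hd p \<in> A \<and> last p \<in> B \<and> interior p \<subseteq> C"

definition odd_split ::
  "'a trigraph \<Rightarrow> 'a set \<Rightarrow> 'a set \<Rightarrow> 'a set \<Rightarrow> 'a set \<Rightarrow> 'a set \<Rightarrow> 'a set \<Rightarrow> bool" where
  "odd_split T A1 B1 C1 A2 B2 C2 \<longleftrightarrow>
     (\<forall>p. side_path T A1 B1 C1 p \<or> side_path T A2 B2 C2 p \<longrightarrow> odd (path_length p))"

definition even_split ::
  "'a trigraph \<Rightarrow> 'a set \<Rightarrow> 'a set \<Rightarrow> 'a set \<Rightarrow> 'a set \<Rightarrow> 'a set \<Rightarrow> 'a set \<Rightarrow> bool" where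
  "even_split T A1 B1 C1 A2 B2 C2 \<longleftrightarrow>
     (\<forall>p. side_path T A1 B1 C1 p \<or> side_path T A2 B2 C2 p \<longrightarrow> even (path_length p))"


section \<open>Homogeneous pairs\<close>

definition compl_part :: "'a trigraph \<Rightarrow> 'a set \<Rightarrow> 'a set \<Rightarrow> 'a set" where
  "compl_part T W S = {v\<in>verts T - W. strongly_complete T v S}"

definition anti_part :: "'a trigraph \<Rightarrow> 'a set \<Rightarrow> 'a set \<Rightarrow> 'a set" where
  "anti_part T W S = {v\<in>verts T - W. strongly_anticomplete T v S}"

definition hp_C :: "'a trigraph \<Rightarrow> 'a set \<Rightarrow> 'a set \<Rightarrow> 'a set" where
  "hp_C T A B = compl_part T (A \<union> B) A \<inter> anti_part T (A \<union> B) B"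

definition hp_D :: "'a trigraph \<Rightarrow> 'a set \<Rightarrow> 'a set \<Rightarrow> 'a set" where
  "hp_D T A B = anti_part T (A \<union> B) A \<inter> compl_part T (A \<union> B) B"

definition hp_E :: "'a trigraph \<Rightarrow> 'a set \<Rightarrow> 'a set \<Rightarrow> 'a set" where
  "hp_E T A B = compl_part T (A \<union> B) A \<inter> compl_part T (A \<union> B) B"

definition hp_F :: "'a trigraph \<Rightarrow> 'a set \<Rightarrow> 'a set \<Rightarrow> 'a set" where
  "hp_F T A B = anti_part T (A \<union> B) A \<inter> anti_part T (A \<union> B) B"

definition proper_homogeneous_pair :: "'a trigraph \<Rightarrow> 'a set \<Rightarrow> 'a set \<Rightarrow> bool" where
  "proper_homogeneous_pair T A B \<longleftrightarrow>
     A \<subseteq> verts T \<and> B \<subseteq> verts T \<and> A \<inter> B = {} \<and> card A > 1 \<and> card B > 1 \<and>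
     compl_part T (A \<union> B) A \<union> anti_part T (A \<union> B) A = verts T - (A \<union> B) \<and>
     compl_part T (A \<union> B) B \<union> anti_part T (A \<union> B) B = verts T - (A \<union> B) \<and>
     (\<forall>a\<in>A. (\<exists>b\<in>B. adj T a b) \<and> (\<exists>b\<in>B. antiadj T a b)) \<and>
     (\<forall>b\<in>B. (\<exists>a\<in>A. adj T b a) \<and> (\<exists>a\<in>A. antiadj T b a)) \<and>
     hp_C T A B \<noteq> {} \<and> hp_D T A B \<noteq> {} \<and> hp_E T A B \<noteq> {} \<and> hp_F T A B \<noteq> {}"


section \<open>Fragments and blocks of decomposition\<close>

definition fragment :: "'a trigraph \<Rightarrow> 'a set \<Rightarrow> bool" where
  "fragment T X \<longleftrightarrow> X \<subseteq> verts T \<and>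
     ((\<exists>A1 B1 C1 A2 B2 C2. proper_two_join T A1 B1 C1 A2 B2 C2 \<and>
         X = A1 \<union> B1 \<union> C1 \<and> verts T - X = A2 \<union> B2 \<union> C2) \<or>
      (\<exists>A1 B1 C1 A2 B2 C2. proper_complement_two_join T A1 B1 C1 A2 B2 C2 \<and>
         X = A1 \<union> B1 \<union> C1 \<and> verts T - X = A2 \<union> B2 \<union> C2) \<or>
      (\<exists>A B. proper_homogeneous_pair T A B \<and> (X = A \<union> B \<or> X = verts T - (A \<union> B))))"

datatype marker = Mk_a | Mk_b | Mk_c | Mk_d

text \<open>
  \<open>add_markers T X M N S R\<close> adds the marker vertices \<open>M\<close> to \<open>T|X\<close>: marker \<open>m\<close> is strongly complete
  to \<open>N m\<close>, the pairs of markers in \<open>S\<close> are switchable, those in \<open>R\<close> strongly adjacent, and all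
  other new pairs are strongly antiadjacent.
\<close>

definition add_markers ::
  "'a trigraph \<Rightarrow> 'a set \<Rightarrow> marker set \<Rightarrow> (marker \<Rightarrow> 'a set) \<Rightarrow> marker set set \<Rightarrow> marker set set
     \<Rightarrow> ('a + marker) trigraph" where
  "add_markers T X M N S R =
     \<lparr>verts = Inl ` X \<union> Inr ` M,
      theta = (\<lambda>u v. case u of
          Inl x \<Rightarrow> (case v of Inl y \<Rightarrow> theta T x y | Inr m \<Rightarrow> if x \<in> N m then 1 else -1)
        | Inr m \<Rightarrow> (case v of Inl x \<Rightarrow> if x \<in> N m then 1 else -1
                    | Inr n \<Rightarrow> if {m, n} \<in> S then 0 else if {m, n} \<in> R then 1 else -1))\<rparr>"

definition block_odd :: "'a trigraph \<Rightarrow> 'a set \<Rightarrow> 'a set \<Rightarrow> 'a set \<Rightarrow> ('a + marker) trigraph" where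
  "block_odd T A1 B1 C1 =
     add_markers T (A1 \<union> B1 \<union> C1) {Mk_a, Mk_b} ((\<lambda>_. {})(Mk_a := A1, Mk_b := B1)) {{Mk_a, Mk_b}} {}"

definition block_even :: "'a trigraph \<Rightarrow> 'a set \<Rightarrow> 'a set \<Rightarrow> 'a set \<Rightarrow> ('a + marker) trigraph" where
  "block_even T A1 B1 C1 =
     add_markers T (A1 \<union> B1 \<union> C1) {Mk_a, Mk_b, Mk_c} ((\<lambda>_. {})(Mk_a := A1, Mk_b := B1))
       {{Mk_a, Mk_c}, {Mk_c, Mk_b}} {}"

definition block_odd_complement ::
  "'a trigraph \<Rightarrow> 'a set \<Rightarrow> 'a set \<Rightarrow> 'a set \<Rightarrow> ('a + marker) trigraph" where
  "block_odd_complement T A1 B1 C1 =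
     add_markers T (A1 \<union> B1 \<union> C1) {Mk_a, Mk_b}
       ((\<lambda>_. {})(Mk_a := B1 \<union> C1, Mk_b := A1 \<union> C1)) {{Mk_a, Mk_b}} {}"

definition block_even_complement ::
  "'a trigraph \<Rightarrow> 'a set \<Rightarrow> 'a set \<Rightarrow> 'a set \<Rightarrow> ('a + marker) trigraph" where
  "block_even_complement T A1 B1 C1 =
     add_markers T (A1 \<union> B1 \<union> C1) {Mk_a, Mk_b, Mk_c}
       ((\<lambda>_. {})(Mk_a := B1 \<union> C1, Mk_b := A1 \<union> C1, Mk_c := A1 \<union> B1 \<union> C1))
       {{Mk_a, Mk_c}, {Mk_c, Mk_b}} {{Mk_a, Mk_b}}"

definition block_hp_inside :: "'a trigraph \<Rightarrow> 'a set \<Rightarrow> 'a set \<Rightarrow> ('a + marker) trigraph" where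
  "block_hp_inside T A B =
     add_markers T (A \<union> B) {Mk_c, Mk_d} ((\<lambda>_. {})(Mk_c := A, Mk_d := B)) {{Mk_c, Mk_d}} {}"

definition block_hp_outside :: "'a trigraph \<Rightarrow> 'a set \<Rightarrow> 'a set \<Rightarrow> ('a + marker) trigraph" where
  "block_hp_outside T A B =
     add_markers T (hp_C T A B \<union> hp_D T A B \<union> hp_E T A B \<union> hp_F T A B) {Mk_a, Mk_b}
       ((\<lambda>_. {})(Mk_a := hp_C T A B \<union> hp_E T A B, Mk_b := hp_D T A B \<union> hp_E T A B))
       {{Mk_a, Mk_b}} {}"

text \<open>
  The same set X may be a fragment through several decompositions or splits, hence a relation:
  every one of them yields a block for X. The lemma \<open>block_exists\<close> below shows that every
  fragment of a Berge trigraph has a block.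
\<close>

inductive is_block :: "'a trigraph \<Rightarrow> 'a set \<Rightarrow> ('a + marker) trigraph \<Rightarrow> bool" for T where
  odd_two_join:
    "proper_two_join T A1 B1 C1 A2 B2 C2 \<Longrightarrow> odd_split T A1 B1 C1 A2 B2 C2 \<Longrightarrow>
     is_block T (A1 \<union> B1 \<union> C1) (block_odd T A1 B1 C1)"
| even_two_join:
    "proper_two_join T A1 B1 C1 A2 B2 C2 \<Longrightarrow> even_split T A1 B1 C1 A2 B2 C2 \<Longrightarrow>
     is_block T (A1 \<union> B1 \<union> C1) (block_even T A1 B1 C1)"
| odd_complement_two_join:
    "proper_complement_two_join T A1 B1 C1 A2 B2 C2 \<Longrightarrow>
     odd_split (complement T) A1 B1 C1 A2 B2 C2 \<Longrightarrow>
     is_block T (A1 \<union> B1 \<union> C1) (block_odd_complement T A1 B1 C1)"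
| even_complement_two_join:
    "proper_complement_two_join T A1 B1 C1 A2 B2 C2 \<Longrightarrow>
     even_split (complement T) A1 B1 C1 A2 B2 C2 \<Longrightarrow>
     is_block T (A1 \<union> B1 \<union> C1) (block_even_complement T A1 B1 C1)"
| hp_inside:
    "proper_homogeneous_pair T A B \<Longrightarrow> is_block T (A \<union> B) (block_hp_inside T A B)"
| hp_outside:
    "proper_homogeneous_pair T A B \<Longrightarrow>
     is_block T (verts T - (A \<union> B)) (block_hp_outside T A B)"

section \<open>Existence of blocks\<close>

lemma complement_complement [simp]: "complement (complement T) = T"
  by (simp add: complement_def)

lemma trigraph_complement: "trigraph T \<Longrightarrow> trigraph (complement T)"
  by (auto simp: trigraph_def complement_def)

lemma berge_complement: "berge T \<Longrightarrow> berge (complement T)"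
  by (simp add: berge_def is_antihole_def)

lemma adj_sym: "trigraph T \<Longrightarrow> adj T u v \<Longrightarrow> adj T v u"
  unfolding trigraph_def adj_def by metis

lemma antiadj_sym: "trigraph T \<Longrightarrow> antiadj T u v \<Longrightarrow> antiadj T v u"
  unfolding trigraph_def antiadj_def by metis

lemma interior_conv_nth: "interior p = {p ! i |i. 0 < i \<and> i < length p - 1}"
proof -
  have "interior p = {butlast (tl p) ! i |i. i < length p - 2}"
    unfolding interior_def set_conv_nth by (simp add: numeral_2_eq_2)
  also have "\<dots> = {p ! Suc i |i. i < length p - 2}"
    by (rule Collect_cong, rule ex_cong1) (auto simp: nth_butlast nth_tl)
  also have "\<dots> = {p ! i |i. 0 < i \<and> i < length p - 1}"
    (is "?L = ?R")
  proof
    show "?L \<subseteq> ?R" by force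
    show "?R \<subseteq> ?L"
    proof
      fix x assume "x \<in> ?R"
      then obtain i where "x = p ! i" "0 < i" "i < length p - 1" by auto
      then have "x = p ! Suc (i - 1)" "i - 1 < length p - 2" by auto
      then show "x \<in> ?L" by blast
    qed
  qed
  finally show ?thesis .
qed

lemma side_path_nth:
  assumes "side_path T A B C p" "A \<inter> B = {}"
  shows "2 \<le> length p" "p ! 0 \<in> A" "p ! (length p - 1) \<in> B"
    "\<And>i. 0 < i \<Longrightarrow> i < length p - 1 \<Longrightarrow> p ! i \<in> C"
proof -
  have ne: "p \<noteq> []" using assms by (auto simp: side_path_def is_path_def)
  show h: "p ! 0 \<in> A" "p ! (length p - 1) \<in> B"
    using assms ne by (auto simp: side_path_def hd_conv_nth last_conv_nth)
  show "2 \<le> length p"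
  proof (rule ccontr)
    assume "\<not> 2 \<le> length p"
    with ne have "length p - 1 = 0" by linarith
    with h assms(2) show False by auto
  qed
  show "\<And>i. 0 < i \<Longrightarrow> i < length p - 1 \<Longrightarrow> p ! i \<in> C"
    using assms(1) by (auto simp: side_path_def interior_conv_nth)
qed

lemma side_paths_hole:
  assumes T: "trigraph T" and J: "two_join T A1 B1 C1 A2 B2 C2"
    and p: "side_path T A1 B1 C1 p" and q: "side_path T A2 B2 C2 q"
  shows "is_hole T (p @ rev q)"
proof -
  have D: "pairwise_disjoint6 A1 B1 C1 A2 B2 C2" using J by (simp add: two_join_def)
  have dj: "A1 \<inter> B1 = {}" "A2 \<inter> B2 = {}" "A1 \<inter> C1 = {}" "B1 \<inter> C1 = {}" "A2 \<inter> C2 = {}" "B2 \<inter> C2 = {}"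
    "(A1 \<union> B1 \<union> C1) \<inter> (A2 \<union> B2 \<union> C2) = {}"
    using D unfolding pairwise_disjoint6_def by (simp_all add: Int_Un_distrib Int_Un_distrib2)
  note P = side_path_nth[OF p dj(1)] and Q = side_path_nth[OF q dj(2)]
  have pp: "is_path T p" and qq: "is_path T q" using p q by (auto simp: side_path_def)
  let ?m = "length p" and ?n = "length q"
  have Pin: "p ! i \<in> A1 \<union> B1 \<union> C1" if "i < ?m" for i
    using P that by (cases "i = 0"; cases "i = ?m - 1") auto
  have Qin: "q ! i \<in> A2 \<union> B2 \<union> C2" if "i < ?n" for i
    using Q that by (cases "i = 0"; cases "i = ?n - 1") auto
  have PA: "i = 0" if "i < ?m" "p ! i \<in> A1" for i
    using P(3) P(4)[of i] that dj by (cases "i = ?m - 1") auto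
  have PB: "i = ?m - 1" if "i < ?m" "p ! i \<in> B1" for i
    using P(2) P(4)[of i] that dj by (cases "i = 0") auto
  have QA: "i = 0" if "i < ?n" "q ! i \<in> A2" for i
    using Q(3) Q(4)[of i] that dj by (cases "i = ?n - 1") auto
  have QB: "i = ?n - 1" if "i < ?n" "q ! i \<in> B2" for i
    using Q(2) Q(4)[of i] that dj by (cases "i = 0") auto
  have sp: "set p \<subseteq> A1 \<union> B1 \<union> C1" "set q \<subseteq> A2 \<union> B2 \<union> C2"
    using Pin Qin unfolding subset_iff in_set_conv_nth by blast+
  have cross: "if (i = 0 \<and> k = 0) \<or> (i = ?m - 1 \<and> k = ?n - 1) then adj T (p ! i) (q ! k)
       else antiadj T (p ! i) (q ! k)" if "i < ?m" "k < ?n" for i k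
  proof (cases "(i = 0 \<and> k = 0) \<or> (i = ?m - 1 \<and> k = ?n - 1)")
    case True
    then have "strong_adj T (p ! i) (q ! k)"
      using J P(2,3) Q(2,3) by (auto simp: two_join_def strongly_complete_def)
    then show ?thesis using True by (auto simp: strong_adj_def adj_def)
  next
    case False
    have "strong_antiadj T (p ! i) (q ! k)"
      using J Pin[OF that(1)] Qin[OF that(2)] False PA[OF that(1)] PB[OF that(1)]
        QA[OF that(2)] QB[OF that(2)] unfolding two_join_def by blast
    then show ?thesis using False by (auto simp: strong_antiadj_def antiadj_def)
  qed
  show ?thesis unfolding is_hole_def
  proof (intro conjI allI impI)
    show "4 \<le> length (p @ rev q)" using P(1) Q(1) by simp
    show "distinct (p @ rev q)" using pp qq sp dj(7) by (auto simp: is_path_def)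
    show "set (p @ rev q) \<subseteq> verts T" using pp qq by (auto simp: is_path_def)
    fix i j assume "i < j \<and> j < length (p @ rev q)"
    then have ij: "i < j" "j < ?m + ?n" by auto
    let ?h = "p @ rev q"
    consider "j < ?m" | "i < ?m" "?m \<le> j" | "?m \<le> i" by linarith
    then show "if j - i \<in> {1, length ?h - 1} then adj T (?h ! i) (?h ! j)
        else antiadj T (?h ! i) (?h ! j)"
    proof cases
      case 1
      then have "?h ! i = p ! i" "?h ! j = p ! j" using ij by (auto simp: nth_append)
      moreover have "(j - i \<in> {1, length ?h - 1}) = (j = i + 1)" using 1 ij Q(1) by auto
      ultimately show ?thesis using pp 1 ij unfolding is_path_def by presburger
    next
      case 2
      define k where "k = ?m + ?n - 1 - j"
      have k: "k < ?n" using 2 ij unfolding k_def by linarith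
      have e: "?h ! i = p ! i" "?h ! j = q ! k" using 2 ij
        by (auto simp: nth_append rev_nth k_def intro!: arg_cong[where f = "(!) q"])
      have "(j - i \<in> {1, length ?h - 1}) = ((i = 0 \<and> k = 0) \<or> (i = ?m - 1 \<and> k = ?n - 1))"
        using 2 ij P(1) Q(1) unfolding k_def by auto
      then show ?thesis using cross[OF 2(1) k] e by simp
    next
      case 3
      define k where "k = ?m + ?n - 1 - j"
      define l where "l = ?m + ?n - 1 - i"
      have kl: "k < l" "l < ?n" using 3 ij unfolding k_def l_def by linarith+
      have e: "?h ! i = q ! l" "?h ! j = q ! k" using 3 ij
        by (auto simp: nth_append rev_nth k_def l_def intro!: arg_cong[where f = "(!) q"])
      have "(j - i \<in> {1, length ?h - 1}) = (l = k + 1)"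
        using 3 ij P(1) unfolding k_def l_def by auto
      moreover have "if l = k + 1 then adj T (q ! k) (q ! l) else antiadj T (q ! k) (q ! l)"
        using qq kl unfolding is_path_def by blast
      ultimately show ?thesis using e adj_sym[OF T] antiadj_sym[OF T] by metis
    qed
  qed
qed

lemma successively_nth: "successively R p \<Longrightarrow> Suc i < length p \<Longrightarrow> R (p ! i) (p ! Suc i)"
proof (induction p arbitrary: i)
  case (Cons x p)
  then show ?case by (cases i; cases p) auto
qed simp

lemma side_path_exists:
  assumes T: "trigraph T" and X: "A \<union> B \<union> C \<subseteq> verts T" and ne: "A \<noteq> {}"
    and comp: "\<And>Y. tri_component (induced T (A \<union> B \<union> C)) Y \<Longrightarrow> Y \<inter> A \<noteq> {} \<and> Y \<inter> B \<noteq> {}"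
  shows "\<exists>p. side_path T A B C p"
proof -
  let ?X = "A \<union> B \<union> C"
  let ?H = "induced T ?X"
  have finX: "finite ?X" using T X unfolding trigraph_def by (metis finite_subset)
  obtain a where a: "a \<in> A" using ne by auto
  define S where "S = {Z. a \<in> Z \<and> Z \<subseteq> ?X \<and> tri_connected ?H Z}"
  have "S \<subseteq> Pow ?X" by (auto simp: S_def)
  then have "finite S" using finX by (meson finite_Pow_iff finite_subset)
  moreover have "{a} \<in> S" using a by (auto simp: S_def tri_connected_def graph_connected_def)
  ultimately obtain Y where Y: "Y \<in> S" "\<And>Z. Z \<in> S \<Longrightarrow> Y \<subseteq> Z \<Longrightarrow> Z = Y"
    using finite_has_maximal[of S] by auto
  have "tri_component ?H Y"
    unfolding tri_component_def using Y by (auto simp: S_def induced_def)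
  from comp[OF this] obtain b where b: "b \<in> B" "b \<in> Y" by auto
  define R where "R u v \<longleftrightarrow> u \<in> ?X \<and> v \<in> ?X \<and> adj T u v" for u v
  have "(a, b) \<in> {(x, y). {x, y} \<in> full_realization (induced ?H Y)}\<^sup>*"
    using Y(1) b by (auto simp: S_def tri_connected_def graph_connected_def)
  then have "\<exists>p. p \<noteq> [] \<and> hd p = a \<and> last p = b \<and> successively R p \<and> set p \<subseteq> ?X"
  proof (induction rule: rtrancl_induct)
    case base
    show ?case using a by (intro exI[of _ "[a]"]) auto
  next
    case (step y z)
    then obtain p where p: "p \<noteq> []" "hd p = a" "last p = y" "successively R p" "set p \<subseteq> ?X" by auto
    have "R y z"
    proof -
      from step.hyps(2) obtain u v where uv: "{y, z} = {u, v}" "adj (induced ?H Y) u v"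
        by (auto simp: full_realization_def)
      have YX: "Y \<subseteq> ?X" using Y(1) by (simp add: S_def)
      from uv(2) have "u \<in> Y" "v \<in> Y" "u \<noteq> v" "theta T u v \<in> {0, 1}"
        by (simp_all add: adj_def induced_def)
      with YX X have "R u v" unfolding R_def adj_def by (meson subsetD)
      then show ?thesis using uv(1) adj_sym[OF T] by (auto simp: R_def doubleton_eq_iff)
    qed
    then show ?case using p
      by (intro exI[of _ "p @ [z]"]) (auto simp: successively_append_iff R_def)
  qed
  then have "\<exists>p. p \<noteq> [] \<and> hd p \<in> A \<and> last p \<in> B \<and> successively R p \<and> set p \<subseteq> ?X"
    using a b by blast
  then obtain p where p: "p \<noteq> []" "hd p \<in> A" "last p \<in> B" "successively R p" "set p \<subseteq> ?X"
    and min: "\<And>r. r \<noteq> [] \<Longrightarrow> hd r \<in> A \<Longrightarrow> last r \<in> B \<Longrightarrow> successively R r \<Longrightarrow> set r \<subseteq> ?X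
        \<Longrightarrow> length p \<le> length r"
    using ex_has_least_nat[of "\<lambda>p. p \<noteq> [] \<and> hd p \<in> A \<and> last p \<in> B \<and> successively R p \<and> set p \<subseteq> ?X" _ length]
    by (metis (no_types, lifting))
  have sd: "successively R (drop i p)" "successively R (take i p)" for i
    using p(4) successively_append_iff[of R "take i p" "drop i p"] by auto
  have sets: "set (drop i p) \<subseteq> ?X" "set (take i p) \<subseteq> ?X" for i
    using p(5) set_drop_subset[of i p] set_take_subset[of i p] by blast+
  have nA: "p ! i \<notin> A" if "0 < i" "i < length p" for i
  proof
    assume "p ! i \<in> A"
    then show False using min[of "drop i p"] that p(3) sd sets
      by (auto simp: hd_drop_conv_nth)
  qed
  have nB: "p ! i \<notin> B" if "i < length p - 1" for i
  proof
    assume "p ! i \<in> B"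
    moreover have "last (take (Suc i) p) = p ! i" using that by (simp add: take_Suc_conv_app_nth)
    ultimately show False using min[of "take (Suc i) p"] that p(1,2) sd sets by auto
  qed
  have neq: "p ! i \<noteq> p ! j" if "i < j" "j < length p" for i j
  proof
    assume e: "p ! i = p ! j"
    let ?r = "take i p @ drop j p"
    have "successively R (take (Suc i) p)" by (rule sd)
    moreover have "take (Suc i) p = take i p @ [p ! i]"
      using that by (simp add: take_Suc_conv_app_nth)
    ultimately have "successively R ?r"
      using sd that e by (auto simp: successively_append_iff hd_drop_conv_nth)
    moreover have "hd ?r \<in> A" using p(2) e that hd_conv_nth[OF p(1)]
      by (cases "i = 0") (auto simp: hd_drop_conv_nth hd_append)
    moreover have "last ?r \<in> B" using p(3) that by simp
    ultimately show False using min[of ?r] that sets by auto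
  qed
  have nadj: "\<not> adj T (p ! i) (p ! j)" if "Suc i < j" "j < length p" for i j
  proof
    assume e: "adj T (p ! i) (p ! j)"
    let ?r = "take (Suc i) p @ drop j p"
    have "last (take (Suc i) p) = p ! i" using that by (simp add: take_Suc_conv_app_nth)
    moreover have "R (p ! i) (p ! j)" using e p(5) that unfolding R_def
      by (meson Suc_lessD less_trans nth_mem subsetD)
    ultimately have "successively R ?r"
      using sd that by (auto simp: successively_append_iff hd_drop_conv_nth)
    moreover have "hd ?r \<in> A" using p(1,2) by (simp add: hd_append)
    moreover have "last ?r \<in> B" using p(3) that by simp
    ultimately show False using min[of ?r] that sets by auto
  qed
  have inV: "p ! i \<in> verts T" if "i < length p" for i using p(5) X that by (meson nth_mem subsetD)
  have "is_path T p" unfolding is_path_def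
  proof (intro conjI allI impI)
    show "p \<noteq> []" by (rule p(1))
    show "distinct p" unfolding distinct_conv_nth using neq by (metis linorder_neqE_nat)
    show "set p \<subseteq> verts T" using p(5) X by blast
    fix i j assume ij: "i < j \<and> j < length p"
    show "if j = i + 1 then adj T (p ! i) (p ! j) else antiadj T (p ! i) (p ! j)"
    proof (cases "j = i + 1")
      case True
      then show ?thesis using successively_nth[OF p(4), of i] ij by (auto simp: R_def)
    next
      case False
      then have "\<not> adj T (p ! i) (p ! j)" using nadj ij by simp
      moreover have "theta T (p ! i) (p ! j) \<in> {-1, 0, 1}"
        using T inV ij neq unfolding trigraph_def by (meson less_trans)
      ultimately show ?thesis using False inV ij neq[of i j] by (auto simp: adj_def antiadj_def)
    qed
  qed
  moreover have "interior p \<subseteq> C"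
  proof
    fix x assume "x \<in> interior p"
    then obtain i where i: "x = p ! i" "0 < i" "i < length p - 1" by (auto simp: interior_conv_nth)
    then have "x \<in> set p" by simp
    then have "x \<in> ?X" using p(5) by blast
    then show "x \<in> C" using i nA[of i] nB[of i] by auto
  qed
  ultimately show ?thesis using p(2,3) unfolding side_path_def by blast
qed

lemma proper_two_join_parity:
  assumes T: "trigraph T" "berge T" and J: "proper_two_join T A1 B1 C1 A2 B2 C2"
  shows "odd_split T A1 B1 C1 A2 B2 C2 \<or> even_split T A1 B1 C1 A2 B2 C2"
proof -
  have J2: "two_join T A1 B1 C1 A2 B2 C2" using J by (simp add: proper_two_join_def)
  have D: "pairwise_disjoint6 A1 B1 C1 A2 B2 C2" using J2 by (simp add: two_join_def)
  then have dj: "A1 \<inter> B1 = {}" "A2 \<inter> B2 = {}" by (auto simp: pairwise_disjoint6_def)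
  have V: "A1 \<union> B1 \<union> C1 \<subseteq> verts T" "A2 \<union> B2 \<union> C2 \<subseteq> verts T" "A1 \<noteq> {}" "A2 \<noteq> {}"
    using J2 by (auto simp: two_join_def two_join_side_def)
  obtain p0 where p0: "side_path T A1 B1 C1 p0"
    using side_path_exists[OF T(1) V(1,3)] J unfolding proper_two_join_def by blast
  obtain q0 where q0: "side_path T A2 B2 C2 q0"
    using side_path_exists[OF T(1) V(2,4)] J unfolding proper_two_join_def by blast
  have par: "even (path_length p) = even (path_length q)"
    if "side_path T A1 B1 C1 p" "side_path T A2 B2 C2 q" for p q
  proof -
    have "even (length (p @ rev q))"
      using side_paths_hole[OF T(1) J2 that] T(2) by (auto simp: berge_def)
    then show ?thesis
      using side_path_nth(1)[OF that(1) dj(1)] side_path_nth(1)[OF that(2) dj(2)]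
      by (auto simp: path_length_def)
  qed
  show ?thesis unfolding odd_split_def even_split_def using par p0 q0 by blast
qed

lemma block_exists:
  assumes T: "trigraph T" "berge T" and X: "fragment T X"
  shows "\<exists>TX. is_block T X TX"
  using X unfolding fragment_def
proof (elim conjE disjE exE)
  fix A1 B1 C1 A2 B2 C2
  assume "proper_two_join T A1 B1 C1 A2 B2 C2" "X = A1 \<union> B1 \<union> C1"
  then show ?thesis using proper_two_join_parity[OF T] is_block.intros(1,2) by metis
next
  fix A1 B1 C1 A2 B2 C2
  assume "proper_complement_two_join T A1 B1 C1 A2 B2 C2" "X = A1 \<union> B1 \<union> C1"
  then show ?thesis
    using proper_two_join_parity[OF trigraph_complement[OF T(1)] berge_complement[OF T(2)]]
      is_block.intros(3,4) unfolding proper_complement_two_join_def by metis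
qed (use is_block.intros(5,6) in metis)+

end

theory Submission
  imports Defs
begin

text \<open>
  The conditions on switchable pairs are inherited from \<open>T\<close>, so the point is that a block is Berge.
  A hole or antihole with at most one marker lifts to \<open>T\<close>: replace the marker by a suitable vertex
  outside \<open>X\<close>. For a 2-join, a hole with two or more markers consists of markers and side paths
  and is even because of their parities, while in an antihole of length at least seven any two
  vertices have a common neighbour, which the two markers \<open>a\<close> and \<open>b\<close> do not have. For the inside
  of a homogeneous pair, every vertex sees exactly one of the two markers, which is impossible in
  an odd hole or antihole through both. For the outside, a switchable pair of markers lifts to an
  adjacent or an antiadjacent pair between \<open>A\<close> and \<open>B\<close>, according to its role in the hole.
  Complement 2-joins reduce to 2-joins since the class is closed under complementation.
\<close>

section \<open>Holes\<close>

lemma hole_nth: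
  assumes "is_hole T h" "i < j" "j < length h"
  shows "if j - i \<in> {1, length h - 1} then adj T (h ! i) (h ! j) else antiadj T (h ! i) (h ! j)"
  using assms unfolding is_hole_def by blast

lemma adj_complement [simp]: "adj (complement T) = antiadj T"
  by (intro ext) (auto simp: adj_def antiadj_def complement_def)

lemma antiadj_complement [simp]: "antiadj (complement T) = adj T"
  by (intro ext) (auto simp: adj_def antiadj_def complement_def)

lemma verts_complement [simp]: "verts (complement T) = verts T"
  by (simp add: complement_def)

section \<open>Choosing the first vertex of a hole\<close>

text \<open>Only pairs with the old head change their order; for these the positions wrap around the
  cycle, and symmetry of \<open>theta\<close> on distinct vertices is used.\<close>

lemma hole_rotate1:
  assumes T: "trigraph T" and h: "is_hole T h"
  shows "is_hole T (rotate1 h)"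
proof -
  obtain x xs where xs: "h = x # xs" using h by (cases h) (auto simp: is_hole_def)
  let ?g = "xs @ [x]"
  have "if j - i \<in> {1, length ?g - 1} then adj T (?g ! i) (?g ! j) else antiadj T (?g ! i) (?g ! j)"
    if ij: "i < j" "j < length ?g" for i j
  proof (cases "j = length xs")
    case True
    then have e: "?g ! i = h ! Suc i" "?g ! j = h ! 0" using ij xs by (auto simp: nth_append)
    have "(j - i \<in> {1, length ?g - 1}) = (Suc i - 0 \<in> {1, length h - 1})"
      using True ij xs by auto
    moreover have "Suc i < length h" using True ij xs by simp
    ultimately show ?thesis
      using hole_nth[OF h, of 0 "Suc i"] e adj_sym[OF T] antiadj_sym[OF T]
      by (metis zero_less_Suc)
  next
    case False
    then have "?g ! i = h ! Suc i" "?g ! j = h ! Suc j" "Suc j < length h" using ij xs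
      by (auto simp: nth_append)
    moreover have "length ?g = length h" using xs by simp
    moreover have "Suc i < Suc j" using ij by simp
    ultimately show ?thesis using hole_nth[OF h, of "Suc i" "Suc j"] by (metis diff_Suc_Suc)
  qed
  then show ?thesis using h unfolding is_hole_def xs by auto
qed

text \<open>With the chosen vertex at index 0, its neighbours on the hole sit at indices
  \<open>1\<close> and \<open>length h - 1\<close>, and all pairs of other indices can be compared
  without wrapping around.\<close>

lemma hole_start_at:
  assumes T: "trigraph T" and h: "is_hole T h" and x: "x \<in> set h"
  obtains g where "is_hole T g" "set g = set h" "length g = length h" "g ! 0 = x"
proof -
  obtain i where i: "i < length h" "h ! i = x" using x by (auto simp: in_set_conv_nth)
  have "is_hole T (rotate i h)"
    by (induction i) (use h hole_rotate1[OF T] in auto)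
  moreover have "rotate i h ! 0 = x"
    using i nth_rotate[of 0 h i] by (cases h) auto
  ultimately show ?thesis using that[of "rotate i h"] by simp
qed

section \<open>A criterion for being Berge\<close>

text \<open>The five-cycle is self-complementary: multiplying indices by 2 modulo 5 exchanges
  consecutive and non-consecutive pairs.\<close>

lemma antihole5_is_hole:
  assumes T: "trigraph T" and h: "is_antihole T h" and n: "length h = 5"
  shows "is_hole T [h ! 0, h ! 2, h ! 4, h ! 1, h ! 3]"
proof -
  obtain a b c d e where e: "h = [a, b, c, d, e]"
    using n by (auto simp: numeral_eq_Suc length_Suc_conv)
  have H: "is_hole (complement T) h" using h by (simp add: is_antihole_def)
  have "antiadj T a b" "antiadj T b c" "antiadj T c d" "antiadj T d e" "antiadj T a e"
    "adj T a c" "adj T a d" "adj T b d" "adj T b e" "adj T c e"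
    using hole_nth[OF H, of 0 1] hole_nth[OF H, of 1 2] hole_nth[OF H, of 2 3]
      hole_nth[OF H, of 3 4] hole_nth[OF H, of 0 4] hole_nth[OF H, of 0 2]
      hole_nth[OF H, of 0 3] hole_nth[OF H, of 1 3] hole_nth[OF H, of 1 4]
      hole_nth[OF H, of 2 4] by (simp_all add: e numeral_eq_Suc)
  moreover from this have "antiadj T c b" "antiadj T e d" "antiadj T b a" "antiadj T d c"
      "adj T c a" "adj T d a" "adj T d b" "adj T e b" "adj T e c" "antiadj T e a"
    by (auto intro: adj_sym[OF T] antiadj_sym[OF T])
  \<comment> \<open>Bounded quantifiers let the simplifier unroll the condition into the ten pairs
    collected above.\<close>
  ultimately have A: "\<forall>j<5. \<forall>i<j. if j - i \<in> {1, 5 - 1} then adj T ([a, c, e, b, d] ! i) ([a, c, e, b, d] ! j)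
      else antiadj T ([a, c, e, b, d] ! i) ([a, c, e, b, d] ! j)"
    by (simp add: numeral_eq_Suc all_simps(6)[symmetric] less_Suc_eq imp_disjL all_conj_distrib)
  define g where "g = [a, c, e, b, d]"
  have g: "g = [h ! 0, h ! 2, h ! 4, h ! 1, h ! 3]" by (simp add: g_def e)
  have "distinct h" "set h \<subseteq> verts T" using H by (auto simp: is_hole_def)
  then have "distinct g" "set g \<subseteq> verts T" "length g = 5" by (auto simp: e g_def)
  then show ?thesis using A unfolding is_hole_def g_def[symmetric] g[symmetric] by auto
qed

text \<open>An odd antihole has length at least 5, and one of length 5 is a hole after reordering.
  So odd antiholes need attention only from length 7 on, where common-neighbour arguments
  work.\<close>

lemma bergeI:
  assumes T: "trigraph T"
    and hole: "\<And>h. is_hole T h \<Longrightarrow> even (length h)"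
    and antihole: "\<And>h. is_antihole T h \<Longrightarrow> 7 \<le> length h \<Longrightarrow> even (length h)"
  shows "berge T"
proof -
  have "even (length h)" if h: "is_antihole T h" for h
  proof (cases "7 \<le> length h")
    case False
    have "4 \<le> length h" using h by (simp add: is_antihole_def is_hole_def)
    moreover have "length h \<noteq> 5" using antihole5_is_hole[OF T h] hole by fastforce
    ultimately have "length h = 4 \<or> length h = 6" using False by linarith
    then show ?thesis by auto
  qed (use antihole[OF h] in simp)
  then show ?thesis using hole unfolding berge_def by blast
qed

section \<open>Transport of holes into another trigraph\<close>

text \<open>Being a hole depends only on \<open>theta\<close> between distinct vertices of the hole.
  The map \<open>f\<close> will replace markers by vertices of \<open>T\<close>; nothing is asked of
  it off the hole.\<close>

lemma hole_map:
  assumes h: "is_hole H h" and f: "inj_on f (set h)" "f ` set h \<subseteq> verts T"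
    and th: "\<And>u v. u \<in> set h \<Longrightarrow> v \<in> set h \<Longrightarrow> u \<noteq> v \<Longrightarrow> theta T (f u) (f v) = theta H u v"
  shows "is_hole T (map f h)"
proof -
  have d: "distinct h" using h by (simp add: is_hole_def)
  have "if j - i \<in> {1, length h - 1} then adj T (f (h ! i)) (f (h ! j))
      else antiadj T (f (h ! i)) (f (h ! j))" if ij: "i < j" "j < length h" for i j
  proof -
    have m: "h ! i \<in> set h" "h ! j \<in> set h" "h ! i \<noteq> h ! j"
      using ij d by (auto simp: nth_eq_iff_index_eq)
    then have "f (h ! i) \<noteq> f (h ! j)" "f (h ! i) \<in> verts T" "f (h ! j) \<in> verts T"
      using f by (auto simp: inj_on_def)
    then show ?thesis using hole_nth[OF h ij] th[OF m]
      by (auto simp: adj_def antiadj_def split: if_splits)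
  qed
  then show ?thesis using h f by (auto simp: is_hole_def distinct_map)
qed

text \<open>The pair \<open>{x, y}\<close> has only one role in the hole. If it is consecutive, it
  suffices that \<open>f\<close> makes it adjacent; otherwise it suffices that \<open>g\<close>
  makes it antiadjacent. All other pairs are transported exactly. This serves to replace a
  switchable pair of markers by vertices of \<open>T\<close>.\<close>

lemma hole_map_pair:
  assumes T: "trigraph T" and h: "is_hole H h"
    and f: "inj_on f (set h)" "f ` set h \<subseteq> verts T" "adj T (f x) (f y)"
      "\<And>u v. u \<in> set h \<Longrightarrow> v \<in> set h \<Longrightarrow> u \<noteq> v \<Longrightarrow> {u, v} \<noteq> {x, y} \<Longrightarrow> theta T (f u) (f v) = theta H u v"
    and g: "inj_on g (set h)" "g ` set h \<subseteq> verts T" "antiadj T (g x) (g y)"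
      "\<And>u v. u \<in> set h \<Longrightarrow> v \<in> set h \<Longrightarrow> u \<noteq> v \<Longrightarrow> {u, v} \<noteq> {x, y} \<Longrightarrow> theta T (g u) (g v) = theta H u v"
  shows "is_hole T (map f h) \<or> is_hole T (map g h)"
proof -
  have d: "distinct h" using h by (simp add: is_hole_def)
  have other: "if j - i \<in> {1, length h - 1} then adj T (k (h ! i)) (k (h ! j))
      else antiadj T (k (h ! i)) (k (h ! j))"
    if ij: "i < j" "j < length h" and ne: "{h ! i, h ! j} \<noteq> {x, y}" and k: "k = f \<or> k = g" for i j k
  proof -
    have m: "h ! i \<in> set h" "h ! j \<in> set h" "h ! i \<noteq> h ! j"
      using ij d by (auto simp: nth_eq_iff_index_eq)
    then have "k (h ! i) \<noteq> k (h ! j)" "k (h ! i) \<in> verts T" "k (h ! j) \<in> verts T"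
      using f(1,2) g(1,2) k by (auto simp: inj_on_def)
    moreover have "theta T (k (h ! i)) (k (h ! j)) = theta H (h ! i) (h ! j)"
      using k f(4)[OF m ne] g(4)[OF m ne] by auto
    ultimately show ?thesis using hole_nth[OF h ij]
      by (auto simp: adj_def antiadj_def split: if_splits)
  qed
  \<comment> \<open>Distinctness puts \<open>{x, y}\<close> at no more than one pair of positions,
    so its role in the hole is well defined.\<close>
  have uniq: "i = i' \<and> j = j'"
    if "i < j" "j < length h" "i' < j'" "j' < length h"
      "{h ! i, h ! j} = {x, y}" "{h ! i', h ! j'} = {x, y}" for i j i' j'
  proof -
    have "{h ! i, h ! j} = {h ! i', h ! j'}" using that by simp
    then have "(h ! i = h ! i' \<and> h ! j = h ! j') \<or> (h ! i = h ! j' \<and> h ! j = h ! i')"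
      by (auto simp: doubleton_eq_iff)
    then show ?thesis using that(1-4) d by (auto simp: nth_eq_iff_index_eq)
  qed
  have fxy: "adj T (f (h ! i)) (f (h ! j))" if "{h ! i, h ! j} = {x, y}" for i j
    using that f(3) adj_sym[OF T f(3)] by (auto simp: doubleton_eq_iff)
  have gxy: "antiadj T (g (h ! i)) (g (h ! j))" if "{h ! i, h ! j} = {x, y}" for i j
    using that g(3) antiadj_sym[OF T g(3)] by (auto simp: doubleton_eq_iff)
  have base: "is_hole T (map k h)" if k: "k = f \<or> k = g"
    and xy: "\<And>i j. i < j \<Longrightarrow> j < length h \<Longrightarrow> {h ! i, h ! j} = {x, y} \<Longrightarrow>
      if j - i \<in> {1, length h - 1} then adj T (k (h ! i)) (k (h ! j))
      else antiadj T (k (h ! i)) (k (h ! j))" for k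
  proof -
    have "if j - i \<in> {1, length h - 1} then adj T (k (h ! i)) (k (h ! j))
      else antiadj T (k (h ! i)) (k (h ! j))" if "i < j" "j < length h" for i j
      using other[OF that _ k] xy[OF that] by blast
    then show ?thesis using h f(1,2) g(1,2) k by (auto simp: is_hole_def distinct_map)
  qed
  show ?thesis
  proof (cases "\<exists>i j. i < j \<and> j < length h \<and> {h ! i, h ! j} = {x, y} \<and> j - i \<in> {1, length h - 1}")
    case True
    then obtain i j where ij: "i < j" "j < length h" "{h ! i, h ! j} = {x, y}" "j - i \<in> {1, length h - 1}"
      by blast
    have "is_hole T (map f h)"
    proof (rule base)
      fix i' j' assume "i' < j'" "j' < length h" "{h ! i', h ! j'} = {x, y}"
      then show "if j' - i' \<in> {1, length h - 1} then adj T (f (h ! i')) (f (h ! j'))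
        else antiadj T (f (h ! i')) (f (h ! j'))"
        using uniq[OF ij(1,2) _ _ ij(3), of i' j'] ij fxy by auto
    qed simp
    then show ?thesis ..
  next
    \<comment> \<open>This also covers holes that miss \<open>x\<close> or \<open>y\<close>, where
      the condition on the pair is vacuous.\<close>
    case False
    have "is_hole T (map g h)"
    proof (rule base)
      fix i' j' assume "i' < j'" "j' < length h" "{h ! i', h ! j'} = {x, y}"
      then show "if j' - i' \<in> {1, length h - 1} then adj T (g (h ! i')) (g (h ! j'))
        else antiadj T (g (h ! i')) (g (h ! j'))"
        using False gxy by auto
    qed simp
    then show ?thesis ..
  qed
qed

section \<open>Common antineighbours in odd holes\<close>

text \<open>The vertices \<open>x\<close>, \<open>y\<close> and their neighbours along the hole
  number at most six, so a hole of length at least 7 has a vertex far from both. In length 5,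
  consecutive vertices leave the opposite one, and non-consecutive ones have a common neighbour.
  Applied to the complement, this gives common neighbours in antiholes.\<close>

lemma odd_hole_common_antineighbour:
  assumes T: "trigraph T" and h: "is_hole T h" "odd (length h)"
    and x: "x \<in> set h" and y: "y \<in> set h" "x \<noteq> y"
  shows "(\<exists>z\<in>set h - {x, y}. antiadj T z x \<and> antiadj T z y) \<or>
    (length h = 5 \<and> (\<exists>z\<in>set h - {x, y}. adj T z x \<and> adj T z y))"
proof -
  obtain g where g: "is_hole T g" "set g = set h" "length g = length h" "g ! 0 = x"
    using hole_start_at[OF T h(1) x] .
  let ?n = "length h"
  have n: "?n \<ge> 5" using h by (auto simp: is_hole_def) (metis even_numeral le_neq_implies_less Suc_leI eval_nat_numeral(3))
  obtain k where k: "k < ?n" "g ! k = y" using y(1) g by (metis in_set_conv_nth)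
  have "k \<noteq> 0" using k y g by metis
  have d: "distinct g" using g by (simp add: is_hole_def)
  have z: "g ! t \<in> set h - {x, y}" if "t < ?n" "t \<noteq> 0" "t \<noteq> k" for t
    using that g k d nth_eq_iff_index_eq[OF d, of t 0] nth_eq_iff_index_eq[OF d, of t k]
    by (metis Diff_iff bot_nat_0.not_eq_extremum empty_iff insert_iff less_trans nth_mem)
  have x0: "if t \<in> {1, ?n - 1} then adj T (g ! t) x else antiadj T (g ! t) x" if "0 < t" "t < ?n" for t
    using hole_nth[OF g(1), of 0 t] that g
    by (auto intro: adj_sym[OF T] antiadj_sym[OF T] split: if_splits)
  have yk: "if t = k + 1 \<or> k = t + 1 then adj T (g ! t) y else antiadj T (g ! t) y"
    if "0 < t" "t < ?n" "t \<noteq> k" for t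
  proof (cases "t < k")
    case True
    have "(k - t \<in> {1, ?n - 1}) = (k = t + 1)" using that True k by auto
    then show ?thesis using hole_nth[OF g(1) True] k g True by auto
  next
    case False
    then have "k < t" using that by simp
    have "(t - k \<in> {1, ?n - 1}) = (t = k + 1)" using that \<open>k < t\<close> \<open>k \<noteq> 0\<close> by auto
    then show ?thesis using hole_nth[OF g(1) \<open>k < t\<close>] k g \<open>k < t\<close> that
      by (auto intro: adj_sym[OF T] antiadj_sym[OF T])
  qed
  \<comment> \<open>The witness of \<open>far\<close> is an index at cyclic distance at least two
    from both \<open>0\<close> and \<open>k\<close>; that of \<open>near\<close> lies between them
    on a 5-hole.\<close>
  have far: ?thesis if "2 \<le> t" "t \<le> ?n - 2" "t \<noteq> k" "t \<noteq> k + 1" "k \<noteq> t + 1" for t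
    using z[of t] x0[of t] yk[of t] that n by (intro disjI1 bexI[of _ "g ! t"]) (auto split: if_splits)
  have near: ?thesis if "?n = 5" "t = 1 \<or> t = 4" "t = k + 1 \<or> k = t + 1" for t
    using z[of t] x0[of t] yk[of t] that \<open>k \<noteq> 0\<close> by (intro disjI2 conjI bexI[of _ "g ! t"]) (auto split: if_splits)
  consider "k = 1" | "k = 2" | "k = 3" | "k = ?n - 1" | "4 \<le> k" "k \<le> ?n - 2"
    using \<open>k \<noteq> 0\<close> k by linarith
  then show ?thesis
  proof cases
    case 1 then show ?thesis using far[of 3] n by auto
  next
    case 2 
    show ?thesis
    proof (cases "?n = 5")
      case True then show ?thesis using near[of 1] 2 by auto
    next
      case False
      then have "?n \<ge> 6" using n by simp
      then show ?thesis using far[of 4] 2 by auto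
    qed
  next
    case 3
    show ?thesis
    proof (cases "?n = 5")
      case True then show ?thesis using near[of 4] 3 by auto
    next
      case False
      then have "?n \<ge> 6" using n by simp
      \<comment> \<open>Opposite vertices of a 6-cycle leave no vertex non-consecutive to both;
        oddness excludes this length.\<close>
      moreover have "?n \<noteq> 6" using h(2) by auto
      ultimately have "?n \<ge> 7" by linarith
      then show ?thesis using far[of 5] 3 by auto
    qed
  next
    case 4 then show ?thesis using far[of 2] n by auto
  next
    case 5 then show ?thesis using far[of 2] by auto
  qed
qed

section \<open>Adding markers\<close>

lemma verts_add_markers [simp]: "verts (add_markers T X M N S R) = Inl ` X \<union> Inr ` M"
  by (simp add: add_markers_def)

lemma theta_add_markers [simp]:
  "theta (add_markers T X M N S R) (Inl x) (Inl y) = theta T x y"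
  "theta (add_markers T X M N S R) (Inl x) (Inr m) = (if x \<in> N m then 1 else -1)"
  "theta (add_markers T X M N S R) (Inr m) (Inl x) = (if x \<in> N m then 1 else -1)"
  "theta (add_markers T X M N S R) (Inr m) (Inr n) =
     (if {m, n} \<in> S then 0 else if {m, n} \<in> R then 1 else -1)"
  by (simp_all add: add_markers_def)

lemma trigraph_add_markers:
  assumes T: "trigraph T" "X \<subseteq> verts T" "finite M"
  shows "trigraph (add_markers T X M N S R)"
proof -
  have "finite X" using T by (auto simp: trigraph_def intro: finite_subset)
  moreover have "theta T x y \<in> {-1, 0, 1} \<and> theta T x y = theta T y x" if "x \<in> X" "y \<in> X" "x \<noteq> y" for x y
    using T that unfolding trigraph_def by blast
  moreover have "theta H u v \<in> {-1, 0, 1} \<and> theta H u v = theta H v u"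
    if "H = add_markers T X M N S R" "u \<in> verts H" "v \<in> verts H" "u \<noteq> v" for H u v
    using that calculation(2) by (cases u; cases v) (auto simp: insert_commute)
  ultimately show ?thesis using T(3) unfolding trigraph_def by simp
qed

text \<open>The vertex \<open>w\<close> outside \<open>X\<close> sees \<open>X\<close> exactly as
  the marker \<open>m\<close> does, so putting it in place of \<open>m\<close> turns the hole into
  one of \<open>T\<close>. The same map works in the complement.\<close>

lemma one_marker_hole_even:
  assumes B: "trigraph T" "berge T" and X: "X \<subseteq> verts T" and w: "w \<in> verts T - X"
    and N: "\<And>x. x \<in> X \<Longrightarrow> if x \<in> N m then strong_adj T x w else strong_antiadj T x w"
    and h: "is_hole (add_markers T X M N S R) h \<or> is_antihole (add_markers T X M N S R) h"
    and one: "set h \<subseteq> Inl ` X \<union> {Inr m}"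
  shows "even (length h)"
proof -
  \<comment> \<open>All markers go to \<open>w\<close>; this is injective on the hole because
    \<open>m\<close> is the only marker it may contain and \<open>w\<close> is not in
    \<open>X\<close>.\<close>
  let ?f = "case_sum id (\<lambda>_. w)" and ?H = "add_markers T X M N S R"
  have inj: "inj_on ?f (set h)"
  proof (rule inj_onI)
    fix u v assume "u \<in> set h" "v \<in> set h" and eq: "?f u = ?f v"
    then have "u \<in> Inl ` X \<union> {Inr m}" "v \<in> Inl ` X \<union> {Inr m}" using one by auto
    then show "u = v" using w eq by auto
  qed
  have im: "?f ` set h \<subseteq> verts T"
  proof
    fix y assume "y \<in> ?f ` set h"
    then obtain u where "u \<in> Inl ` X \<union> {Inr m}" "y = ?f u" using one by blast
    then show "y \<in> verts T" using w X by auto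
  qed
  have xw: "theta T x w = (if x \<in> N m then 1 else -1)" "theta T w x = theta T x w" if "x \<in> X" for x
  proof -
    have "x \<noteq> w" "x \<in> verts T" "w \<in> verts T" using that w X by auto
    then show "theta T x w = (if x \<in> N m then 1 else -1)" "theta T w x = theta T x w"
      using N[OF that] B(1) by (auto simp: strong_adj_def strong_antiadj_def trigraph_def)
  qed
  have th: "theta T (?f u) (?f v) = theta ?H u v" if "u \<in> set h" "v \<in> set h" "u \<noteq> v" for u v
  proof -
    have "u \<in> Inl ` X \<union> {Inr m}" "v \<in> Inl ` X \<union> {Inr m}" using that one by auto
    then show ?thesis using that(3) xw by auto
  qed
  show ?thesis
  proof (cases "is_hole ?H h")
    case True
    from hole_map[OF this inj im th] have "is_hole T (map ?f h)" by blast
    then show ?thesis using B(2) unfolding berge_def by (metis length_map)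
  next
    case False
    then have "is_hole (complement ?H) h" using h by (simp add: is_antihole_def)
    then have "is_hole (complement T) (map ?f h)"
      by (rule hole_map[OF _ inj]) (use im th in \<open>auto simp: complement_def\<close>)
    then show ?thesis using B(2) unfolding berge_def is_antihole_def by (metis length_map)
  qed
qed

section \<open>Arcs of holes through markers\<close>

text \<open>Pairs of a marker and a vertex of \<open>X\<close> are never switchable, so positions on
  the hole determine membership in \<open>N m\<close> exactly. The last two alternatives are the
  closing pair of the cyclic order.\<close>

lemma hole_marker_neighbour:
  assumes h: "is_hole (add_markers T X M N S R) h"
    and k: "k < length h" "h ! k = Inr m" and t: "t < length h" "h ! t = Inl x"
  shows "x \<in> N m \<longleftrightarrow> t = k + 1 \<or> k = t + 1 \<or> (t = 0 \<and> k = length h - 1) \<or> (k = 0 \<and> t = length h - 1)"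
proof -
  have "t \<noteq> k" using k t by auto
  then consider "t < k" | "k < t" by linarith
  then show ?thesis
  proof cases
    case 1
    have "(k - t \<in> {1, length h - 1}) \<longleftrightarrow>
        t = k + 1 \<or> k = t + 1 \<or> (t = 0 \<and> k = length h - 1) \<or> (k = 0 \<and> t = length h - 1)"
      using 1 k t by auto
    then show ?thesis using hole_nth[OF h 1 k(1)] k t
      by (auto simp: adj_def antiadj_def split: if_splits)
  next
    case 2
    have "(t - k \<in> {1, length h - 1}) \<longleftrightarrow>
        t = k + 1 \<or> k = t + 1 \<or> (t = 0 \<and> k = length h - 1) \<or> (k = 0 \<and> t = length h - 1)"
      using 2 k t by auto
    then show ?thesis using hole_nth[OF h 2 t(1)] k t
      by (auto simp: adj_def antiadj_def split: if_splits)
  qed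
qed

text \<open>A stretch of a hole is an induced path as long as it omits a vertex; here index 0 is
  omitted, where a marker will sit.\<close>

lemma hole_arc_side_path:
  assumes h: "is_hole (add_markers T X M N S R) h" and X: "X \<subseteq> verts T"
    and ij: "0 < i" "i < j" "j < length h"
    and ends: "h ! i \<in> Inl ` A" "h ! j \<in> Inl ` B"
    and int: "\<And>t. i < t \<Longrightarrow> t < j \<Longrightarrow> h ! t \<in> Inl ` C"
    and sub: "A \<union> B \<union> C \<subseteq> X"
  shows "\<exists>p. side_path T A B C p \<and> path_length p = j - i"
proof -
  define p where "p = map (\<lambda>t. projl (h ! t)) [i..<Suc j]"
  have len: "length p = Suc (j - i)" using ij by (simp add: p_def)
  have nth: "p ! s = projl (h ! (i + s))" if "s < length p" for s
    using that len by (simp add: p_def del: upt_Suc)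
  have mem: "h ! (i + s) = Inl (p ! s)" "p ! s \<in> X" if "s < length p" for s
  proof -
    have "s = 0 \<or> i + s = j \<or> (i < i + s \<and> i + s < j)" using that len ij by linarith
    then have "h ! (i + s) \<in> Inl ` X" using ends int[of "i + s"] sub by auto
    then show "h ! (i + s) = Inl (p ! s)" "p ! s \<in> X" using nth[OF that] by auto
  qed
  have d: "distinct h" using h by (simp add: is_hole_def)
  have neq: "p ! s \<noteq> p ! t" if "s < t" "t < length p" for s t
  proof
    assume "p ! s = p ! t"
    then have "h ! (i + s) = h ! (i + t)" using mem that by simp
    then show False using d that len ij by (simp add: nth_eq_iff_index_eq)
  qed
  have "is_path T p" unfolding is_path_def
  proof (intro conjI allI impI)
    show "p \<noteq> []" using len by auto
    show "distinct p" unfolding distinct_conv_nth using neq by (metis linorder_neqE_nat)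
    show "set p \<subseteq> verts T" using mem(2) X by (force simp: in_set_conv_nth)
    fix s t assume st: "s < t \<and> t < length p"
    then have "i + t < length h" using len ij by linarith
    \<comment> \<open>Since \<open>0 < i\<close>, the difference stays below
      \<open>length h - 1\<close>, so the closing pair of the hole does not occur.\<close>
    moreover have "(i + t) - (i + s) \<in> {1, length h - 1} \<longleftrightarrow> t = s + 1" using st len ij by auto
    ultimately have "if t = s + 1 then adj (add_markers T X M N S R) (Inl (p ! s)) (Inl (p ! t))
        else antiadj (add_markers T X M N S R) (Inl (p ! s)) (Inl (p ! t))"
      using hole_nth[OF h, of "i + s" "i + t"] mem(1)[of s] mem(1)[of t] st
      by (cases "t = s + 1") auto
    then show "if t = s + 1 then adj T (p ! s) (p ! t) else antiadj T (p ! s) (p ! t)"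
      using X by (auto simp: adj_def antiadj_def split: if_splits)
  qed
  moreover have "p \<noteq> []" using len by auto
  then have "hd p \<in> A" "last p \<in> B"
    using ends mem(1)[of 0] mem(1)[of "j - i"] len ij by (auto simp: hd_conv_nth last_conv_nth)
  moreover have "interior p \<subseteq> C"
  proof
    fix x assume "x \<in> interior p"
    then obtain s where s: "x = p ! s" "0 < s" "s < length p - 1" by (auto simp: interior_conv_nth)
    then have "h ! (i + s) \<in> Inl ` C" using len ij by (intro int) linarith+
    then show "x \<in> C" using s mem(1)[of s] by auto
  qed
  ultimately show ?thesis using len by (auto simp: side_path_def path_length_def)
qed

lemma side_path_rev:
  assumes T: "trigraph T" and p: "side_path T A B C p"
  shows "side_path T B A C (rev p)"
proof -
  have P: "is_path T p" and ne: "p \<noteq> []" using p by (auto simp: side_path_def is_path_def)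
  have "is_path T (rev p)" unfolding is_path_def
  proof (intro conjI allI impI)
    fix i j assume ij: "i < j \<and> j < length (rev p)"
    define s t where "s = length p - Suc i" and "t = length p - Suc j"
    have "rev p ! i = p ! s" "rev p ! j = p ! t" "t < s" "s < length p" "(j = i + 1) = (s = t + 1)"
      using ij by (auto simp: rev_nth s_def t_def)
    then show "if j = i + 1 then adj T (rev p ! i) (rev p ! j) else antiadj T (rev p ! i) (rev p ! j)"
      using P adj_sym[OF T] antiadj_sym[OF T] unfolding is_path_def by metis
  qed (use P in \<open>auto simp: is_path_def\<close>)
  moreover have "interior (rev p) = interior p"
    unfolding interior_def by (metis butlast_rev butlast_tl rev_rev_ident set_rev)
  ultimately show ?thesis using p ne by (auto simp: side_path_def hd_rev last_rev)
qed

text \<open>The Boolean \<open>P\<close> stands for the common parity of the side paths, so odd and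
  even 2-joins share one proof. The form of \<open>ends\<close> allows the arc to run in either
  direction.\<close>

lemma hole_arc_parity:
  assumes T: "trigraph T" and h: "is_hole (add_markers T X M N S R) h" and X: "X \<subseteq> verts T"
    and ij: "0 < i" "i < j" "j < length h"
    and ends: "h ! i \<in> Inl ` A \<and> h ! j \<in> Inl ` B \<or> h ! i \<in> Inl ` B \<and> h ! j \<in> Inl ` A"
    and int: "\<And>t. i < t \<Longrightarrow> t < j \<Longrightarrow> h ! t \<in> Inl ` C"
    and sub: "A \<union> B \<union> C \<subseteq> X"
    and par: "\<And>p. side_path T A B C p \<Longrightarrow> odd (path_length p) = P"
  shows "odd (j - i) = P"
proof -
  have "\<exists>p. side_path T A B C p \<and> path_length p = j - i"
    using ends
  proof
    assume "h ! i \<in> Inl ` A \<and> h ! j \<in> Inl ` B"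
    then show ?thesis using hole_arc_side_path[OF h X ij _ _ int sub] by blast
  next
    assume e: "h ! i \<in> Inl ` B \<and> h ! j \<in> Inl ` A"
    have "B \<union> A \<union> C \<subseteq> X" using sub by blast
    then obtain p where "side_path T B A C p" "path_length p = j - i"
      using hole_arc_side_path[OF h X ij _ _ int] e by blast
    then show ?thesis using side_path_rev[OF T] by (metis length_rev path_length_def)
  qed
  then show ?thesis using par by metis
qed

section \<open>Switchable pairs of a block\<close>

lemma connected_in_component:
  assumes "finite V" "Z \<subseteq> V" "Z \<noteq> {}" "graph_connected Z {e\<in>E. e \<subseteq> Z}"
  obtains Y where "graph_component V E Y" "Z \<subseteq> Y"
proof -
  define K where "K = {Y. Z \<subseteq> Y \<and> Y \<subseteq> V \<and> graph_connected Y {e\<in>E. e \<subseteq> Y}}"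
  have "K \<subseteq> Pow V" by (auto simp: K_def)
  then have "finite K" using assms(1) by (meson finite_Pow_iff finite_subset)
  moreover have "Z \<in> K" using assms by (simp add: K_def)
  ultimately obtain Y where Y: "Y \<in> K" "\<And>W. W \<in> K \<Longrightarrow> Y \<subseteq> W \<Longrightarrow> W = Y"
    using finite_has_maximal[of K] by auto
  have "graph_component V E Y" unfolding graph_component_def
  proof (intro conjI allI impI)
    fix W assume "Y \<subseteq> W \<and> W \<subseteq> V \<and> graph_connected W {e\<in>E. e \<subseteq> W}"
    then show "W = Y" using Y(1) by (intro Y(2)) (auto simp: K_def)
  qed (use Y(1) assms(3) in \<open>auto simp: K_def\<close>)
  then show ?thesis using that Y(1) by (auto simp: K_def)
qed

text \<open>Every connected set lies in a component, so the bound on components passes to it. For a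
  component of a block, its old vertices then only have to be shown connected in \<open>T\<close>,
  not maximal.\<close>

lemma class_F_connected_card:
  assumes T: "T \<in> class_F" and Z: "Z \<subseteq> verts T" "Z \<noteq> {}"
    "graph_connected Z {e\<in>switchable_edges T. e \<subseteq> Z}"
  shows "card {e\<in>switchable_edges T. e \<subseteq> Z} \<le> 2"
proof -
  have fin: "finite (verts T)" using T by (simp add: class_F_def trigraph_def)
  obtain Y where Y: "graph_component (verts T) (switchable_edges T) Y" "Z \<subseteq> Y"
    using connected_in_component[OF fin Z] .
  then have "{e\<in>switchable_edges T. e \<subseteq> Y} \<subseteq> Pow (verts T)" by (auto simp: graph_component_def)
  then have "finite {e\<in>switchable_edges T. e \<subseteq> Y}" using fin by (meson finite_Pow_iff finite_subset)
  then have "card {e\<in>switchable_edges T. e \<subseteq> Z} \<le> card {e\<in>switchable_edges T. e \<subseteq> Y}"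
    using Y(2) by (intro card_mono) auto
  also have "\<dots> \<le> 2" using T Y by (simp add: class_F_def)
  finally show ?thesis .
qed

lemma switchable_add_markers:
  assumes "X \<subseteq> verts T"
  shows "switchable (add_markers T X M N S R) (Inl x) (Inl y) \<longleftrightarrow> x \<in> X \<and> y \<in> X \<and> switchable T x y"
    "\<not> switchable (add_markers T X M N S R) (Inl x) (Inr m)"
    "\<not> switchable (add_markers T X M N S R) (Inr m) (Inl x)"
    "switchable (add_markers T X M N S R) (Inr m) (Inr n) \<longleftrightarrow> m \<in> M \<and> n \<in> M \<and> m \<noteq> n \<and> {m, n} \<in> S"
  using assms by (auto simp: switchable_def)

lemma switchable_edgesE:
  assumes "e \<in> switchable_edges T"
  obtains u v where "e = {u, v}" "switchable T u v"
  using assms by (auto simp: switchable_edges_def)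

text \<open>No switchable pair joins an old vertex to a marker, so a component lies on one side of
  the sum type. On the left it projects to a connected set of \<open>T\<close>; on the right its
  edges come from \<open>S\<close>.\<close>

lemma add_markers_component_card:
  assumes T: "T \<in> class_F" and X: "X \<subseteq> verts T" and S: "finite S" "card S \<le> 2"
    and Y: "graph_component (verts (add_markers T X M N S R)) (switchable_edges (add_markers T X M N S R)) Y"
  shows "card {e\<in>switchable_edges (add_markers T X M N S R). e \<subseteq> Y} \<le> 2"
proof -
  let ?H = "add_markers T X M N S R"
  let ?E = "{e\<in>switchable_edges ?H. e \<subseteq> Y}"
  have Ysub: "Y \<noteq> {}" "Y \<subseteq> Inl ` X \<union> Inr ` M" and con: "graph_connected Y ?E"
    using Y by (auto simp: graph_component_def)
  have edge: "(\<exists>x y. u = Inl x \<and> v = Inl y \<and> x \<in> X \<and> y \<in> X \<and> switchable T x y) \<or>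
      (\<exists>m n. u = Inr m \<and> v = Inr n \<and> {m, n} \<in> S)" if "switchable ?H u v" for u v
    using that switchable_add_markers[OF X, of M N S R] by (cases u; cases v) auto
  have edge2: "isl u = isl v" if "{u, v} \<in> ?E" for u v
  proof -
    have "{u, v} \<in> switchable_edges ?H" using that by simp
    then obtain u' v' where "{u, v} = {u', v'}" "switchable ?H u' v'" by (rule switchable_edgesE)
    then show ?thesis using edge[of u' v'] by (auto simp: doubleton_eq_iff)
  qed
  have same: "isl u = isl v" if "u \<in> Y" "v \<in> Y" for u v
  proof -
    have "(u, v) \<in> {(x, y). {x, y} \<in> ?E}\<^sup>*" using con that by (simp add: graph_connected_def)
    then show ?thesis by (induction rule: rtrancl_induct) (use edge2 in blast)+
  qed
  obtain y0 where "y0 \<in> Y" using Ysub by blast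
  show ?thesis
  proof (cases "isl y0")
    case True
    then have inl: "isl u" if "u \<in> Y" for u using same[OF that \<open>y0 \<in> Y\<close>] by simp
    define Z where "Z = Inl -` Y"
    let ?F = "{e\<in>switchable_edges T. e \<subseteq> Z}"
    have Z: "Z \<subseteq> verts T" "Z \<noteq> {}"
      using Ysub X \<open>y0 \<in> Y\<close> True by (auto simp: Z_def isl_def)
    have E: "\<exists>x y. {u, v} = {Inl x, Inl y} \<and> {x, y} \<in> ?F" if "{u, v} \<in> ?E" for u v
    proof -
      have "{u, v} \<in> switchable_edges ?H" using that by simp
      then obtain u' v' where e: "{u, v} = {u', v'}" "switchable ?H u' v'" by (rule switchable_edgesE)
      then have Y': "u' \<in> Y" "v' \<in> Y" using that unfolding e(1) by auto
      then show ?thesis using edge[OF e(2)] e(1) inl[of u'] by (auto simp: Z_def switchable_edges_def)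
    qed
    have proj: "{projl u, projl v} \<in> ?F" if uv: "{u, v} \<in> ?E" for u v
    proof -
      obtain x y where xy: "{u, v} = {Inl x, Inl y}" "{x, y} \<in> ?F" using E[OF uv] by blast
      then have "{projl u, projl v} = {x, y}" by (auto simp: doubleton_eq_iff)
      then show ?thesis using xy(2) by simp
    qed
    \<comment> \<open>A walk is projected edge by edge; \<open>projl\<close> is harmless because
      \<open>Y\<close> contains no marker in this case.\<close>
    have "graph_connected Z ?F" unfolding graph_connected_def
    proof (intro ballI)
      fix x y assume "x \<in> Z" "y \<in> Z"
      then have "(Inl x, Inl y) \<in> {(x, y). {x, y} \<in> ?E}\<^sup>*"
        using con by (simp add: graph_connected_def Z_def)
      then have "(projl (Inl x :: 'a + marker), projl (Inl y :: 'a + marker)) \<in> {(x, y). {x, y} \<in> ?F}\<^sup>*"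
      proof (induction rule: rtrancl_induct)
        case (step v w)
        then have "(projl v, projl w) \<in> {(x, y). {x, y} \<in> ?F}" using proj by blast
        then show ?case using step.IH by (rule rtrancl_into_rtrancl[rotated])
      qed simp
      then show "(x, y) \<in> {(x, y). {x, y} \<in> ?F}\<^sup>*" by simp
    qed
    then have c: "card ?F \<le> 2" using class_F_connected_card[OF T Z] by blast
    have "?F \<subseteq> Pow (verts T)" using Z by auto
    then have fin: "finite ?F" using T by (auto simp: class_F_def trigraph_def intro: finite_subset)
    have "?E \<subseteq> (`) Inl ` ?F"
    proof
      fix e assume e: "e \<in> ?E"
      then obtain u v where "e = {u, v}" by (auto simp: switchable_edges_def)
      then obtain x y where "e = {Inl x, Inl y}" "{x, y} \<in> ?F" using E[of u v] e by blast
      then show "e \<in> (`) Inl ` ?F" by (intro image_eqI[of _ _ "{x, y}"]) auto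
    qed
    then have "card ?E \<le> card ?F" using fin by (meson card_image_le card_mono finite_imageI le_trans)
    then show ?thesis using c by simp
  next
    case False
    then have inr: "\<not> isl u" if "u \<in> Y" for u using same[OF that \<open>y0 \<in> Y\<close>] by simp
    have "?E \<subseteq> (`) Inr ` S"
    proof
      fix e assume e: "e \<in> ?E"
      then obtain u v where uv: "e = {u, v}" "switchable ?H u v" by (auto simp: switchable_edges_def)
      then obtain m n where "u = Inr m" "v = Inr n" "{m, n} \<in> S" using edge[OF uv(2)] e inr[of u] by auto
      then show "e \<in> (`) Inr ` S" using uv by (intro image_eqI[of _ _ "{m, n}"]) auto
    qed
    then have "card ?E \<le> card S" using S(1) by (meson card_image_le card_mono finite_imageI le_trans)
    then show ?thesis using S(2) by simp
  qed
qed

section \<open>Membership of a block in the class\<close>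

text \<open>The assumptions isolate what a block must supply. By \<open>nosw\<close>, an old vertex
  keeps its switchable neighbours; \<open>full\<close> and \<open>void\<close> carry strong
  completeness and anticompleteness from the deleted vertices over to the markers;
  \<open>mark\<close> treats a marker with two switchable neighbours, which must be strongly
  anticomplete to the rest.\<close>

lemma add_markers_class_F:
  assumes T: "T \<in> class_F" and X: "X \<subseteq> verts T" and M: "finite M" and S: "finite S" "card S \<le> 2"
    and nosw: "\<And>x w. x \<in> X \<Longrightarrow> w \<in> verts T - X \<Longrightarrow> \<not> switchable T x w"
    and full: "\<And>x m. x \<in> X \<Longrightarrow> strongly_complete T x (verts T - X) \<Longrightarrow> m \<in> M \<Longrightarrow> x \<in> N m"
    and void: "\<And>x m. x \<in> X \<Longrightarrow> strongly_anticomplete T x (verts T - X) \<Longrightarrow> m \<in> M \<Longrightarrow> x \<notin> N m"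
    and mark: "\<And>m p q. m \<in> M \<Longrightarrow> p \<noteq> q \<Longrightarrow> {n\<in>M. n \<noteq> m \<and> {m, n} \<in> S} = {p, q} \<Longrightarrow>
      N m = {} \<and> M = {m, p, q} \<and> {p, q} \<notin> S \<union> R"
    and B: "berge (add_markers T X M N S R)"
  shows "add_markers T X M N S R \<in> class_F"
proof -
  let ?H = "add_markers T X M N S R"
  note sw = switchable_add_markers[OF X, of M N S R]
  have tri: "trigraph T" using T by (simp add: class_F_def)
  have deg: "(strongly_complete ?H v (verts ?H - {v, x, y}) \<and> strong_adj ?H x y) \<or>
        (strongly_anticomplete ?H v (verts ?H - {v, x, y}) \<and> strong_antiadj ?H x y)"
    if v: "v \<in> verts ?H" and xy: "x \<noteq> y" and e: "{w. switchable ?H v w} = {x, y}" for v x y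
  proof (cases v)
    case (Inl v')
    have v': "v' \<in> X" using v Inl by auto
    have vx: "switchable ?H v x" "switchable ?H v y" using e by auto
    then obtain x' y' where x': "x = Inl x'" "x' \<in> X" "switchable T v' x'"
      and y': "y = Inl y'" "y' \<in> X" "switchable T v' y'"
      using sw Inl by (cases x; cases y) auto
    have "{w. switchable T v' w} = {x', y'}"
    proof -
      have "w \<in> {x', y'}" if w: "switchable T v' w" for w
      proof -
        have "w \<in> X" using nosw[OF v', of w] w by (auto simp: switchable_def)
        then have "switchable ?H v (Inl w)" using sw(1) Inl v' w by simp
        then have "Inl w \<in> {x, y}" using e by blast
        then show ?thesis using x' y' by auto
      qed
      then show ?thesis using x' y' by blast
    qed
    moreover have "v' \<in> verts T" "x' \<noteq> y'" using v' X xy x' y' by auto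
    ultimately have "(strongly_complete T v' (verts T - {v', x', y'}) \<and> strong_adj T x' y') \<or>
        (strongly_anticomplete T v' (verts T - {v', x', y'}) \<and> strong_antiadj T x' y')"
      using T unfolding class_F_def by blast
    then show ?thesis
    proof (elim disjE conjE)
      assume c: "strongly_complete T v' (verts T - {v', x', y'})" "strong_adj T x' y'"
      \<comment> \<open>The exceptional vertices \<open>v'\<close>, \<open>x'\<close>,
        \<open>y'\<close> all lie in \<open>X\<close>, so none of them is a deleted vertex and
        \<open>full\<close> applies.\<close>
      then have "strongly_complete T v' (verts T - X)"
        using v' x' y' unfolding strongly_complete_def by blast
      then have m: "v' \<in> N m" if "m \<in> M" for m using full[OF v'] that by blast
      have "strongly_complete ?H v (verts ?H - {v, x, y})" unfolding strongly_complete_def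
      proof
        fix w assume w: "w \<in> verts ?H - {v, x, y}"
        show "strong_adj ?H v w"
        proof (cases w)
          case (Inl w')
          then have "w' \<in> X" "w' \<in> verts T - {v', x', y'}" using w X x' y' \<open>v = Inl v'\<close> by auto
          then show ?thesis using c(1) v' Inl \<open>v = Inl v'\<close>
            by (auto simp: strongly_complete_def strong_adj_def)
        next
          case (Inr m')
          then show ?thesis using w m \<open>v = Inl v'\<close> v' by (auto simp: strong_adj_def)
        qed
      qed
      moreover have "strong_adj ?H x y" using c(2) x' y' by (auto simp: strong_adj_def)
      ultimately show ?thesis by blast
    next
      assume c: "strongly_anticomplete T v' (verts T - {v', x', y'})" "strong_antiadj T x' y'"
      then have "strongly_anticomplete T v' (verts T - X)"
        using v' x' y' unfolding strongly_anticomplete_def by blast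
      then have m: "v' \<notin> N m" if "m \<in> M" for m using void[OF v'] that by blast
      have "strongly_anticomplete ?H v (verts ?H - {v, x, y})" unfolding strongly_anticomplete_def
      proof
        fix w assume w: "w \<in> verts ?H - {v, x, y}"
        show "strong_antiadj ?H v w"
        proof (cases w)
          case (Inl w')
          then have "w' \<in> X" "w' \<in> verts T - {v', x', y'}" using w X x' y' \<open>v = Inl v'\<close> by auto
          then show ?thesis using c(1) v' Inl \<open>v = Inl v'\<close>
            by (auto simp: strongly_anticomplete_def strong_antiadj_def)
        next
          case (Inr m')
          then show ?thesis using w m \<open>v = Inl v'\<close> v' by (auto simp: strong_antiadj_def)
        qed
      qed
      moreover have "strong_antiadj ?H x y" using c(2) x' y' by (auto simp: strong_antiadj_def)
      ultimately show ?thesis by blast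
    qed
  next
    case (Inr m)
    have m: "m \<in> M" using v Inr by auto
    have vx: "switchable ?H v x" "switchable ?H v y" using e by auto
    then obtain p q where p: "x = Inr p" and q: "y = Inr q"
      using sw Inr by (cases x; cases y) auto
    have "n \<in> {p, q}" if "n \<in> M" "n \<noteq> m" "{m, n} \<in> S" for n
    proof -
      have "switchable ?H v (Inr n)" using sw(4) Inr m that by simp
      then have "Inr n \<in> {x, y}" using e by blast
      then show ?thesis using p q by auto
    qed
    then have set: "{n\<in>M. n \<noteq> m \<and> {m, n} \<in> S} = {p, q}" using vx sw(4) p q Inr by auto
    have "p \<noteq> q" using xy p q by auto
    from mark[OF m this set] have N: "N m = {}" "M = {m, p, q}" "{p, q} \<notin> S" "{p, q} \<notin> R" by auto
    have "strong_antiadj ?H v w" if w: "w \<in> verts ?H - {v, x, y}" for w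
      using w Inr m N p q by (cases w) (auto simp: strong_antiadj_def)
    moreover have "strong_antiadj ?H x y" using p q N \<open>p \<noteq> q\<close> by (auto simp: strong_antiadj_def)
    ultimately show ?thesis by (auto simp: strongly_anticomplete_def)
  qed
  show ?thesis unfolding class_F_def
    using trigraph_add_markers[OF tri X M] B add_markers_component_card[OF T X S] deg by blast
qed

section \<open>2-joins\<close>

text \<open>Provides representatives of the markers: towards the first side, each vertex of
  \<open>A2\<close> behaves like the marker \<open>a\<close> and each vertex of \<open>B2\<close>
  like \<open>b\<close>.\<close>

lemma two_join_cross:
  assumes J: "two_join T A1 B1 C1 A2 B2 C2" and x: "x \<in> A1 \<union> B1 \<union> C1"
  shows "w \<in> A2 \<Longrightarrow> if x \<in> A1 then strong_adj T x w else strong_antiadj T x w"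
    and "w \<in> B2 \<Longrightarrow> if x \<in> B1 then strong_adj T x w else strong_antiadj T x w"
proof -
  have dj: "A2 \<inter> B2 = {}" "A1 \<inter> B1 = {}"
    using J by (auto simp: two_join_def pairwise_disjoint6_def)
  have anti: "strong_antiadj T x w"
    if "w \<in> A2 \<union> B2 \<union> C2" "\<not> (x \<in> A1 \<and> w \<in> A2)" "\<not> (x \<in> B1 \<and> w \<in> B2)"
    using J x that unfolding two_join_def by blast
  show "if x \<in> A1 then strong_adj T x w else strong_antiadj T x w" if "w \<in> A2"
    using J that anti dj by (auto simp: two_join_def strongly_complete_def)
  show "if x \<in> B1 then strong_adj T x w else strong_antiadj T x w" if "w \<in> B2"
    using J that anti dj by (auto simp: two_join_def strongly_complete_def)
qed

text \<open>
  The markers \<open>a\<close> and \<open>b\<close> cut the hole into one arc (if they are consecutive) or two arcs, each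
  of which runs along a side path. Two side paths have the same parity; a single one is odd, since
  \<open>a\<close> and \<open>b\<close> are adjacent only in the odd case.
\<close>

lemma hole_through_a_b_even:
  assumes T: "trigraph T" and X: "A \<union> B \<union> C \<subseteq> verts T" and dj: "A \<inter> B = {}" and fin: "finite M"
    and N: "N Mk_a = A" "N Mk_b = B"
    and h: "is_hole (add_markers T (A \<union> B \<union> C) M N S R) h"
    and ab: "Inr Mk_a \<in> set h" "Inr Mk_b \<in> set h"
    and markers: "set h \<subseteq> Inl ` (A \<union> B \<union> C) \<union> {Inr Mk_a, Inr Mk_b}"
    and par: "\<And>p. side_path T A B C p \<Longrightarrow> odd (path_length p) = P"
    and P: "adj (add_markers T (A \<union> B \<union> C) M N S R) (Inr Mk_a) (Inr Mk_b) \<Longrightarrow> P"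
  shows "even (length h)"
proof -
  let ?X = "A \<union> B \<union> C"
  let ?H = "add_markers T ?X M N S R"
  have TH: "trigraph ?H" using trigraph_add_markers[OF T X fin] .
  obtain g where g: "is_hole ?H g" "set g = set h" "length g = length h" "g ! 0 = Inr Mk_a"
    using hole_start_at[OF TH h ab(1)] .
  let ?n = "length g"
  have n: "4 \<le> ?n" and d: "distinct g" using g by (auto simp: is_hole_def)
  obtain k where k: "k < ?n" "g ! k = Inr Mk_b" using ab(2) g(2) by (metis in_set_conv_nth)
  have k0: "k \<noteq> 0" using k g by (metis Inr_inject marker.distinct(1))
  have inl: "\<exists>x\<in>?X. g ! t = Inl x" if "t < ?n" "t \<noteq> 0" "t \<noteq> k" for t
  proof -
    have "g ! t \<in> set h" using that g by (metis nth_mem)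
    moreover have "0 < ?n" using n by linarith
    then have "g ! t \<noteq> g ! 0" "g ! t \<noteq> g ! k" using that k(1) nth_eq_iff_index_eq[OF d] by auto
    ultimately show ?thesis using markers g k by auto
  qed
  \<comment> \<open>With \<open>a\<close> at index 0, its neighbours on the hole sit at the indices
    \<open>1\<close> and \<open>?n - 1\<close>; a vertex of \<open>X\<close> there lies in
    \<open>A\<close>, and no other does.\<close>
  have inA: "g ! t \<in> Inl ` A \<longleftrightarrow> t = 1 \<or> t = ?n - 1" if t: "t < ?n" "t \<noteq> 0" "t \<noteq> k" for t
  proof -
    obtain x where x: "g ! t = Inl x" using inl[OF t] by blast
    have "0 < ?n" using n by linarith
    from hole_marker_neighbour[OF g(1) this g(4) t(1) x] show ?thesis using N n x t by auto
  qed
  have inB: "g ! t \<in> Inl ` B \<longleftrightarrow> t = k + 1 \<or> k = t + 1" if t: "t < ?n" "t \<noteq> 0" "t \<noteq> k" for t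
  proof -
    obtain x where x: "g ! t = Inl x" using inl[OF t] by blast
    show ?thesis using hole_marker_neighbour[OF g(1) k t(1) x] N x t k0 by auto
  qed
  have inC: "g ! t \<in> Inl ` C"
    if "t < ?n" "t \<noteq> 0" "t \<noteq> k" "t \<noteq> 1" "t \<noteq> ?n - 1" "t \<noteq> k + 1" "k \<noteq> t + 1" for t
    using inl[OF that(1-3)] inA[OF that(1-3)] inB[OF that(1-3)] that(4-7) by auto
  have notAB: "\<not> (g ! t \<in> Inl ` A \<and> g ! t \<in> Inl ` B)" for t using dj by auto
  note arc = hole_arc_parity[OF T g(1) X _ _ _ _ _ subset_refl par]
  \<comment> \<open>The marker \<open>b\<close> is next to \<open>a\<close> on one side, on the
    other, or on neither; in the first two cases \<open>a\<close> and \<open>b\<close> are adjacent,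
    which forces \<open>P\<close>.\<close>
  consider "k = 1" | "k = ?n - 1" | "1 < k" "k < ?n - 1" using k k0 by linarith
  then have "even ?n"
  proof cases
    case 1
    then have "adj ?H (Inr Mk_a) (Inr Mk_b)" using hole_nth[OF g(1), of 0 1] g k by auto
    moreover have "odd (?n - 1 - 2) = P"
    proof (rule arc)
      fix t assume "2 < t" "t < ?n - 1"
      then show "g ! t \<in> Inl ` C" using 1 by (intro inC) auto
    qed (use 1 n inA[of "?n - 1"] inB[of 2] in auto)
    ultimately show ?thesis using P n by auto
  next
    case 2
    then have "adj ?H (Inr Mk_a) (Inr Mk_b)" using hole_nth[OF g(1), of 0 k] g k n by auto
    moreover have "odd (?n - 2 - 1) = P"
    proof (rule arc)
      fix t assume "1 < t" "t < ?n - 2"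
      then show "g ! t \<in> Inl ` C" using 2 by (intro inC) auto
    qed (use 2 n inA[of 1] inB[of "?n - 2"] in auto)
    ultimately show ?thesis using P n by auto
  next
    case 3
    \<comment> \<open>A single vertex between \<open>a\<close> and \<open>b\<close> would lie in
      both \<open>A\<close> and \<open>B\<close>, so each of the two arcs has distinct ends.\<close>
    have "k \<noteq> 2" using inA[of 1] inB[of 1] notAB[of 1] 3 by auto
    have "k + 1 \<noteq> ?n - 1" using inA[of "k + 1"] inB[of "k + 1"] notAB[of "k + 1"] 3 by auto
    have "odd (k - 1 - 1) = P"
    proof (rule arc)
      fix t assume "1 < t" "t < k - 1"
      then show "g ! t \<in> Inl ` C" using 3 by (intro inC) auto
    qed (use 3 \<open>k \<noteq> 2\<close> inA[of 1] inB[of "k - 1"] in auto)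
    moreover have "odd (?n - 1 - (k + 1)) = P"
    proof (rule arc)
      fix t assume "k + 1 < t" "t < ?n - 1"
      then show "g ! t \<in> Inl ` C" using 3 by (intro inC) auto
    qed (use 3 \<open>k + 1 \<noteq> ?n - 1\<close> inA[of "?n - 1"] inB[of "k + 1"] in auto)
    \<comment> \<open>The two arcs have equal parity; the 4 counts the edges of the hole at
      \<open>a\<close> and \<open>b\<close>.\<close>
    moreover have "?n = (k - 1 - 1) + (?n - 1 - (k + 1)) + 4" using 3 \<open>k \<noteq> 2\<close> by linarith
    ultimately show ?thesis by (metis even_add even_numeral)
  qed
  then show ?thesis using g by simp
qed

text \<open>The only possible neighbours of \<open>c\<close> are \<open>a\<close> and
  \<open>b\<close>, so a hole through \<open>c\<close> contains the stretch \<open>a\<close>,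
  \<open>c\<close>, \<open>b\<close>. The rest is one side path of even length, and four further
  edges close the hole.\<close>

lemma hole_through_c_even:
  assumes T: "trigraph T" and X: "A \<union> B \<union> C \<subseteq> verts T" and dj: "A \<inter> B = {}" and fin: "finite M"
    and N: "N Mk_a = A" "N Mk_b = B"
    and h: "is_hole (add_markers T (A \<union> B \<union> C) M N S R) h"
    and c: "Inr Mk_c \<in> set h"
    and nbr: "\<And>v. adj (add_markers T (A \<union> B \<union> C) M N S R) (Inr Mk_c) v \<Longrightarrow> v = Inr Mk_a \<or> v = Inr Mk_b"
    and markers: "set h \<subseteq> Inl ` (A \<union> B \<union> C) \<union> {Inr Mk_a, Inr Mk_b, Inr Mk_c}"
    and par: "\<And>p. side_path T A B C p \<Longrightarrow> even (path_length p)"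
  shows "even (length h)"
proof -
  let ?X = "A \<union> B \<union> C"
  let ?H = "add_markers T ?X M N S R"
  have TH: "trigraph ?H" using trigraph_add_markers[OF T X fin] .
  obtain g where g: "is_hole ?H g" "set g = set h" "length g = length h" "g ! 0 = Inr Mk_c"
    using hole_start_at[OF TH h c] .
  let ?n = "length g"
  have n: "4 \<le> ?n" and d: "distinct g" using g by (auto simp: is_hole_def)
  have "adj ?H (g ! 0) (g ! 1)" using hole_nth[OF g(1), of 0 1] n by auto
  then have g1: "g ! 1 = Inr Mk_a \<or> g ! 1 = Inr Mk_b" using nbr g(4) by auto
  have "adj ?H (g ! 0) (g ! (?n - 1))" using hole_nth[OF g(1), of 0 "?n - 1"] n by auto
  then have gn: "g ! (?n - 1) = Inr Mk_a \<or> g ! (?n - 1) = Inr Mk_b" using nbr g(4) by auto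
  have ne: "g ! 1 \<noteq> g ! (?n - 1)"
    using d n nth_eq_iff_index_eq[OF d, of 1 "?n - 1"] by auto
  \<comment> \<open>The hole may leave \<open>c\<close> through \<open>a\<close> or through
    \<open>b\<close>: \<open>A'\<close> belongs to the marker at index 1 and \<open>B'\<close> to
    the one at the last index.\<close>
  define A' B' where "A' = (if g ! 1 = Inr Mk_a then A else B)" and "B' = (if g ! 1 = Inr Mk_a then B else A)"
  obtain m m' where m: "g ! 1 = Inr m" "g ! (?n - 1) = Inr m'" "N m = A'" "N m' = B'"
    using g1 gn ne N by (auto simp: A'_def B'_def)
  have inl: "\<exists>x\<in>?X. g ! t = Inl x" if "1 < t" "t < ?n - 1" for t
  proof -
    have "t < ?n" using that by linarith
    then have "g ! t \<in> set h" using g(2) by (metis nth_mem)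
    moreover have "0 < ?n" "1 < ?n" using n by linarith+
    then have "g ! t \<noteq> g ! 0" "g ! t \<noteq> g ! 1" "g ! t \<noteq> g ! (?n - 1)"
      using that nth_eq_iff_index_eq[OF d, of t] by auto
    ultimately show ?thesis using markers g(4) g1 gn ne by auto
  qed
  have inA: "g ! t \<in> Inl ` A' \<longleftrightarrow> t = 2" if t: "1 < t" "t < ?n - 1" for t
  proof -
    obtain x where x: "g ! t = Inl x" using inl[OF t] by blast
    have "1 < ?n" "t < ?n" using n t by linarith+
    then show ?thesis using hole_marker_neighbour[OF g(1) _ m(1) _ x] m(3) n x t by auto
  qed
  have inB: "g ! t \<in> Inl ` B' \<longleftrightarrow> t = ?n - 2" if t: "1 < t" "t < ?n - 1" for t
  proof -
    obtain x where x: "g ! t = Inl x" using inl[OF t] by blast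
    have "?n - 1 < ?n" "t < ?n" using n t by linarith+
    then show ?thesis using hole_marker_neighbour[OF g(1) _ m(2) _ x] m(4) n x t by auto
  qed
  have notAB: "\<not> (g ! t \<in> Inl ` A' \<and> g ! t \<in> Inl ` B')" for t using dj by (auto simp: A'_def B'_def)
  have ABC: "?X = A' \<union> B' \<union> C" by (auto simp: A'_def B'_def)
  \<comment> \<open>In a 4-hole the vertex opposite \<open>c\<close> would lie in both
    \<open>A\<close> and \<open>B\<close>.\<close>
  have "?n \<noteq> 4" using inA[of 2] inB[of 2] notAB[of 2] by auto
  have ends: "g ! 2 \<in> Inl ` A'" "g ! (?n - 2) \<in> Inl ` B'" using inA[of 2] inB[of "?n - 2"] n \<open>?n \<noteq> 4\<close> by auto
  have "odd (?n - 2 - 2) = False"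
  proof (rule hole_arc_parity[OF T g(1) X, where A = A and B = B and C = C])
    fix t assume "2 < t" "t < ?n - 2"
    then have "1 < t" "t < ?n - 1" "t \<noteq> 2" "t \<noteq> ?n - 2" by linarith+
    then show "g ! t \<in> Inl ` C" using inl[of t] inA[of t] inB[of t] ABC by auto
  next
    show "g ! 2 \<in> Inl ` A \<and> g ! (?n - 2) \<in> Inl ` B \<or> g ! 2 \<in> Inl ` B \<and> g ! (?n - 2) \<in> Inl ` A"
      using ends by (auto simp: A'_def B'_def split: if_splits)
  qed (use n \<open>?n \<noteq> 4\<close> ends par in \<open>auto simp: A'_def B'_def split: if_splits\<close>)
  then show ?thesis using n g(3) by auto
qed

section \<open>Blocks of 2-joins\<close>

text \<open>\<open>P\<close> selects the odd or the even block, so both are handled by one case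
  analysis on the markers that a hole or antihole contains.\<close>

lemma two_join_block_berge:
  assumes T: "trigraph T" "berge T" and J: "two_join T A1 B1 C1 A2 B2 C2"
    and par: "\<And>p. side_path T A1 B1 C1 p \<Longrightarrow> odd (path_length p) = P"
  defines "M \<equiv> if P then {Mk_a, Mk_b} else {Mk_a, Mk_b, Mk_c}"
    and "S \<equiv> if P then {{Mk_a, Mk_b}} else {{Mk_a, Mk_c}, {Mk_c, Mk_b}}"
  shows "berge (add_markers T (A1 \<union> B1 \<union> C1) M ((\<lambda>_. {})(Mk_a := A1, Mk_b := B1)) S {})"
proof -
  let ?X = "A1 \<union> B1 \<union> C1" and ?N = "(\<lambda>_. {})(Mk_a := A1, Mk_b := B1)"
  let ?H = "add_markers T ?X M ?N S {}"
  have X: "?X \<subseteq> verts T" and dj: "A1 \<inter> B1 = {}" "?X \<inter> (A2 \<union> B2 \<union> C2) = {}"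
    and X2: "A2 \<union> B2 \<union> C2 \<subseteq> verts T" and ne: "A2 \<noteq> {}" "B2 \<noteq> {}"
    using J by (auto simp: two_join_def pairwise_disjoint6_def two_join_side_def)
  have fin: "finite M" by (simp add: M_def)
  have TH: "trigraph ?H" by (rule trigraph_add_markers[OF T(1) X fin])
  have MS: "M \<subseteq> {Mk_a, Mk_b, Mk_c}" by (auto simp: M_def)
  obtain a2 b2 where w: "a2 \<in> A2" "b2 \<in> B2" using ne by blast
  have Na: "if x \<in> ?N Mk_a then strong_adj T x a2 else strong_antiadj T x a2" if "x \<in> ?X" for x
    using two_join_cross(1)[OF J that w(1)] by simp
  have Nb: "if x \<in> ?N Mk_b then strong_adj T x b2 else strong_antiadj T x b2" if "x \<in> ?X" for x
    using two_join_cross(2)[OF J that w(2)] by simp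
  have one: "even (length h)"
    if h: "is_hole ?H h \<or> is_antihole ?H h" and c: "Inr Mk_c \<notin> set h"
      and ab: "\<not> (Inr Mk_a \<in> set h \<and> Inr Mk_b \<in> set h)" for h
  proof -
    have "set h \<subseteq> Inl ` ?X \<union> Inr ` M" using h by (auto simp: is_hole_def is_antihole_def)
    then have "set h \<subseteq> Inl ` ?X \<union> {Inr Mk_a, Inr Mk_b}" using c MS by auto
    then consider "set h \<subseteq> Inl ` ?X \<union> {Inr Mk_a}" | "set h \<subseteq> Inl ` ?X \<union> {Inr Mk_b}" using ab by blast
    then show ?thesis
    proof cases
      case 1
      have "a2 \<in> verts T - ?X" using w X2 dj by blast
      then show ?thesis using one_marker_hole_even[OF T X _ Na h 1] by blast
    next
      case 2
      have "b2 \<in> verts T - ?X" using w X2 dj by blast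
      then show ?thesis using one_marker_hole_even[OF T X _ Nb h 2] by blast
    qed
  qed
  have cP: "\<not> P" if "Mk_c \<in> M" using that by (auto simp: M_def split: if_splits)
  have cadj: "v = Inr Mk_a \<or> v = Inr Mk_b" if "adj ?H (Inr Mk_c) v" for v
    using that MS by (cases v) (auto simp: adj_def split: if_splits)
  have abP: "P" if "adj ?H (Inr Mk_a) (Inr Mk_b)"
    using that by (auto simp: adj_def S_def doubleton_eq_iff split: if_splits)
  \<comment> \<open>An old vertex cannot see both markers because \<open>A1\<close> and
    \<open>B1\<close> are disjoint, and neither \<open>a\<close> nor \<open>b\<close> is adjacent to
    itself.\<close>
  have noncommon: "z = Inr Mk_c" if "adj ?H z (Inr Mk_a)" "adj ?H z (Inr Mk_b)" for z
    using that MS dj(1) by (cases z) (auto simp: adj_def split: if_splits)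
  show ?thesis
  proof (rule bergeI[OF TH])
    fix h assume h: "is_hole ?H h"
    then have sub: "set h \<subseteq> Inl ` ?X \<union> Inr ` M" by (auto simp: is_hole_def)
    show "even (length h)"
    proof (cases "Inr Mk_c \<in> set h")
      case True
      then have "\<not> P" using cP sub by auto
      then have ev: "\<And>p. side_path T A1 B1 C1 p \<Longrightarrow> even (path_length p)" using par by simp
      have "set h \<subseteq> Inl ` ?X \<union> {Inr Mk_a, Inr Mk_b, Inr Mk_c}" using sub MS by auto
      then show ?thesis by (intro hole_through_c_even[OF T(1) X dj(1) fin _ _ h True cadj _ ev]) auto
    next
      case False
      show ?thesis
      proof (cases "Inr Mk_a \<in> set h \<and> Inr Mk_b \<in> set h")
        case True
        have "set h \<subseteq> Inl ` ?X \<union> {Inr Mk_a, Inr Mk_b}" using sub MS False by auto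
        then show ?thesis
          using True by (intro hole_through_a_b_even[OF T(1) X dj(1) fin _ _ h _ _ _ par abP]) auto
      next
        case ab: False
        show ?thesis using one[OF _ False ab] h by blast
      qed
    qed
  next
    fix h assume h: "is_antihole ?H h" and n: "7 \<le> length h"
    then have h': "is_hole (complement ?H) h" by (simp add: is_antihole_def)
    have TC: "trigraph (complement ?H)" by (rule trigraph_complement[OF TH])
    \<comment> \<open>In an antihole of length at least 7 starting at \<open>c\<close>, the vertices
      at indices 2, 3 and 4 are neighbours of \<open>c\<close> in the block, one more than
      \<open>c\<close> can have.\<close>
    have c: "Inr Mk_c \<notin> set h"
    proof
      assume "Inr Mk_c \<in> set h"
      then obtain g where g: "is_hole (complement ?H) g" "set g = set h" "length g = length h" "g ! 0 = Inr Mk_c"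
        using hole_start_at[OF TC h'] by blast
      have "adj ?H (Inr Mk_c) (g ! t)" if "t \<in> {2, 3, 4}" for t
      proof -
        have t: "t = 2 \<or> t = 3 \<or> t = 4" using that by simp
        have "0 < t" "t < length g" "t \<noteq> 1" "t \<noteq> length g - 1" using t n g(3) by linarith+
        then show ?thesis using hole_nth[OF g(1), of 0 t] g(4) by simp
      qed
      then have "g ! 2 \<in> {Inr Mk_a, Inr Mk_b}" "g ! 3 \<in> {Inr Mk_a, Inr Mk_b}" "g ! 4 \<in> {Inr Mk_a, Inr Mk_b}"
        using cadj by blast+
      moreover have "distinct g" using g by (simp add: is_hole_def)
      then have "g ! 2 \<noteq> g ! 3" "g ! 2 \<noteq> g ! 4" "g ! 3 \<noteq> g ! 4"
        using n g(3) by (simp_all add: nth_eq_iff_index_eq)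
      ultimately show False by auto
    qed
    show "even (length h)"
    proof (rule ccontr)
      assume odd: "odd (length h)"
      then have ab: "Inr Mk_a \<in> set h" "Inr Mk_b \<in> set h" using one[OF _ c] h by blast+
      \<comment> \<open>In the complement, antineighbours are neighbours in the block; the
        exceptional length 5 is excluded by \<open>n\<close>.\<close>
      obtain z where "z \<in> set h" "adj ?H z (Inr Mk_a)" "adj ?H z (Inr Mk_b)"
        using odd_hole_common_antineighbour[OF TC h' odd ab] n by auto
      then show False using noncommon c by blast
    qed
  qed
qed

lemma two_join_block_class_F:
  assumes T: "T \<in> class_F" and J: "two_join T A1 B1 C1 A2 B2 C2"
    and par: "\<And>p. side_path T A1 B1 C1 p \<Longrightarrow> odd (path_length p) = P"
  shows "(if P then block_odd T A1 B1 C1 else block_even T A1 B1 C1) \<in> class_F"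
proof -
  define M where "M = (if P then {Mk_a, Mk_b} else {Mk_a, Mk_b, Mk_c})"
  define S where "S = (if P then {{Mk_a, Mk_b}} else {{Mk_a, Mk_c}, {Mk_c, Mk_b}})"
  let ?X = "A1 \<union> B1 \<union> C1" and ?N = "(\<lambda>_. {})(Mk_a := A1, Mk_b := B1)"
  have tri: "trigraph T" "berge T" using T by (auto simp: class_F_def)
  have X: "?X \<subseteq> verts T" and X2: "verts T - ?X = A2 \<union> B2 \<union> C2" and ne: "A2 \<noteq> {}" "B2 \<noteq> {}"
    and dj: "A1 \<inter> B1 = {}"
    using J by (auto simp: two_join_def pairwise_disjoint6_def two_join_side_def)
  obtain a2 b2 where w: "a2 \<in> A2" "b2 \<in> B2" using ne by blast
  have "add_markers T ?X M ?N S {} \<in> class_F"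
  proof (rule add_markers_class_F[OF T X])
    show "finite M" "finite S" "card S \<le> 2" by (auto simp: M_def S_def card_insert_if)
    show "\<not> switchable T x w" if "x \<in> ?X" "w \<in> verts T - ?X" for x w
      using J that X2 unfolding two_join_def by blast
    \<comment> \<open>Vacuous: such an \<open>x\<close> would lie in both \<open>A1\<close> and
      \<open>B1\<close>.\<close>
    show "x \<in> ?N m" if x: "x \<in> ?X" and c: "strongly_complete T x (verts T - ?X)" for x m
    proof -
      have "strong_adj T x a2" "strong_adj T x b2" using c w X2 by (auto simp: strongly_complete_def)
      then have "x \<in> A1" "x \<in> B1" using two_join_cross(1)[OF J x w(1)] two_join_cross(2)[OF J x w(2)]
        by (auto simp: strong_adj_def strong_antiadj_def split: if_splits)
      then show ?thesis using dj by blast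
    qed
    show "x \<notin> ?N m" if x: "x \<in> ?X" and c: "strongly_anticomplete T x (verts T - ?X)" for x m
    proof -
      have "strong_antiadj T x a2" "strong_antiadj T x b2" using c w X2 by (auto simp: strongly_anticomplete_def)
      then have "x \<notin> A1" "x \<notin> B1" using two_join_cross(1)[OF J x w(1)] two_join_cross(2)[OF J x w(2)]
        by (auto simp: strong_adj_def strong_antiadj_def split: if_splits)
      then show ?thesis by auto
    qed
    show "?N m = {} \<and> M = {m, p, q} \<and> {p, q} \<notin> S \<union> {}"
      if m: "m \<in> M" and pq: "p \<noteq> q" and e: "{n\<in>M. n \<noteq> m \<and> {m, n} \<in> S} = {p, q}" for m p q
    proof -
      have "p \<in> M \<and> p \<noteq> m \<and> {m, p} \<in> S" "q \<in> M \<and> q \<noteq> m \<and> {m, q} \<in> S" using e by blast+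
      note pq' = this
      show ?thesis
      proof (cases P)
        case True
        then show ?thesis using pq' m pq by (auto simp: M_def)
      next
        case False
        \<comment> \<open>In the even block \<open>a\<close> and \<open>b\<close> have
          \<open>c\<close> as their only switchable neighbour, so only \<open>c\<close> has
          two.\<close>
        have "m = Mk_c"
        proof (rule ccontr)
          assume "m \<noteq> Mk_c"
          then have "p = Mk_c" "q = Mk_c" using pq' False by (auto simp: S_def doubleton_eq_iff)
          then show False using pq by simp
        qed
        moreover have "p = Mk_a \<and> q = Mk_b \<or> p = Mk_b \<and> q = Mk_a"
          using pq' pq False \<open>m = Mk_c\<close> by (auto simp: M_def)
        ultimately show ?thesis using False by (auto simp: M_def S_def doubleton_eq_iff)
      qed
    qed
    show "berge (add_markers T ?X M ?N S {})"
      unfolding M_def S_def by (rule two_join_block_berge[OF tri J par])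
  qed
  then show ?thesis by (simp add: M_def S_def block_odd_def block_even_def split: if_splits)
qed

section \<open>Complements\<close>

text \<open>Values of \<open>theta\<close> on the diagonal or off the vertex set are arbitrary, so
  records describing the same trigraph need not be equal. The class does not distinguish
  them.\<close>

lemma class_F_cong:
  assumes V: "verts T = verts T'"
    and th: "\<And>u v. u \<in> verts T \<Longrightarrow> v \<in> verts T \<Longrightarrow> u \<noteq> v \<Longrightarrow> theta T u v = theta T' u v"
    and T: "T \<in> class_F"
  shows "T' \<in> class_F"
proof -
  have e: "adj T = adj T'" "antiadj T = antiadj T'" "strong_adj T = strong_adj T'"
    "strong_antiadj T = strong_antiadj T'" "switchable T = switchable T'"
    using V th by (auto simp: fun_eq_iff adj_def antiadj_def strong_adj_def strong_antiadj_def switchable_def)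
  have "is_hole T = is_hole T'" "is_antihole T = is_antihole T'"
    by (auto simp: fun_eq_iff is_antihole_def is_hole_def e V)
  then have "berge T = berge T'" by (simp add: berge_def)
  moreover have "trigraph T = trigraph T'" using V th by (auto simp: trigraph_def)
  moreover have "switchable_edges T = switchable_edges T'" by (simp add: switchable_edges_def e)
  ultimately show ?thesis using T
    by (simp add: class_F_def strongly_complete_def strongly_anticomplete_def e V)
qed

text \<open>Complementation keeps switchable pairs and exchanges holes with antiholes as well as the
  two alternatives for vertices of degree two.\<close>

lemma class_F_complement:
  assumes T: "T \<in> class_F"
  shows "complement T \<in> class_F"
proof -
  have e: "strong_adj (complement T) = strong_antiadj T" "strong_antiadj (complement T) = strong_adj T"
    "switchable (complement T) = switchable T"
    by (auto simp: fun_eq_iff strong_adj_def strong_antiadj_def switchable_def complement_def)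
  have "switchable_edges (complement T) = switchable_edges T" by (simp add: switchable_edges_def e)
  then show ?thesis using T trigraph_complement[of T] berge_complement[of T]
    by (simp add: class_F_def strongly_complete_def strongly_anticomplete_def e disj_commute)
qed

text \<open>Under complementation a marker with old neighbours \<open>A1\<close> becomes complete to
  \<open>B1 \<union> C1\<close>, and \<open>c\<close> to the whole side. So the complement of the
  block formed in \<open>complement T\<close> is the required block, up to irrelevant values of
  \<open>theta\<close>.\<close>

lemma complement_two_join_block_class_F:
  assumes T: "T \<in> class_F" and J: "two_join (complement T) A1 B1 C1 A2 B2 C2"
    and par: "\<And>p. side_path (complement T) A1 B1 C1 p \<Longrightarrow> odd (path_length p) = P"
  shows "(if P then block_odd_complement T A1 B1 C1 else block_even_complement T A1 B1 C1) \<in> class_F"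
proof -
  define H where "H = (if P then block_odd (complement T) A1 B1 C1 else block_even (complement T) A1 B1 C1)"
  have F: "complement H \<in> class_F"
    unfolding H_def by (intro class_F_complement two_join_block_class_F[OF class_F_complement[OF T] J par])
  have dj: "A1 \<inter> B1 = {}" "A1 \<inter> C1 = {}" "B1 \<inter> C1 = {}"
    using J by (auto simp: two_join_def pairwise_disjoint6_def)
  have th: "theta (complement H) u v =
      theta (if P then block_odd_complement T A1 B1 C1 else block_even_complement T A1 B1 C1) u v"
    if "u \<in> verts H" "v \<in> verts H" "u \<noteq> v" for u v
  proof (cases P)
    case True
    then show ?thesis using that dj unfolding H_def block_odd_def block_odd_complement_def
      by (cases u; cases v) (auto simp: complement_def doubleton_eq_iff)
  next
    case False
    then show ?thesis using that dj unfolding H_def block_even_def block_even_complement_def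
      by (cases u; cases v) (auto simp: complement_def doubleton_eq_iff)
  qed
  have V: "verts (complement H) =
      verts (if P then block_odd_complement T A1 B1 C1 else block_even_complement T A1 B1 C1)"
    by (simp add: H_def block_odd_def block_odd_complement_def block_even_def block_even_complement_def)
  show ?thesis by (rule class_F_cong[OF V _ F]) (use th in simp)
qed

section \<open>Homogeneous pairs\<close>

text \<open>Two vertices of an odd hole have a common antineighbour or a common neighbour on it,
  while here every other vertex sees exactly one of \<open>c\<close> and \<open>d\<close>. The
  latter survives complementation, so antiholes are covered too.\<close>

lemma odd_hole_not_both:
  assumes T: "trigraph H" and h: "is_hole H h" "odd (length h)" and cd: "c \<noteq> d"
    and split: "\<And>z. z \<in> verts H - {c, d} \<Longrightarrow>
      strong_adj H z c \<and> strong_antiadj H z d \<or> strong_antiadj H z c \<and> strong_adj H z d"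
  shows "\<not> (c \<in> set h \<and> d \<in> set h)"
proof
  assume cdh: "c \<in> set h \<and> d \<in> set h"
  obtain z where "z \<in> set h - {c, d}" "antiadj H z c \<and> antiadj H z d \<or> adj H z c \<and> adj H z d"
    using odd_hole_common_antineighbour[OF T h conjunct1[OF cdh] conjunct2[OF cdh] cd] by blast
  moreover have "set h \<subseteq> verts H" using h by (simp add: is_hole_def)
  ultimately show False using split[of z]
    by (auto simp: adj_def antiadj_def strong_adj_def strong_antiadj_def)
qed

lemma block_hp_inside_class_F:
  assumes T: "T \<in> class_F" and P: "proper_homogeneous_pair T A B"
  shows "block_hp_inside T A B \<in> class_F"
proof -
  let ?X = "A \<union> B" and ?N = "(\<lambda>_. {})(Mk_c := A, Mk_d := B)"
  let ?H = "add_markers T ?X {Mk_c, Mk_d} ?N {{Mk_c, Mk_d}} {}"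
  have tri: "trigraph T" "berge T" using T by (auto simp: class_F_def)
  have X: "?X \<subseteq> verts T" and dj: "A \<inter> B = {}"
    using P by (auto simp: proper_homogeneous_pair_def)
  \<comment> \<open>A vertex of the part \<open>C\<close> sees \<open>A \<union> B\<close> as the
    marker \<open>c\<close> does, and one of the part \<open>D\<close> as the marker
    \<open>d\<close> does.\<close>
  obtain c d where c: "c \<in> hp_C T A B" and d: "d \<in> hp_D T A B"
    using P by (auto simp: proper_homogeneous_pair_def)
  have cd: "c \<in> verts T - ?X" "d \<in> verts T - ?X"
    using c d by (auto simp: hp_C_def hp_D_def compl_part_def)
  have sym: "strong_adj T x y" if "strong_adj T y x" for x y
    using that tri(1) by (auto simp: strong_adj_def trigraph_def)
  have asym: "strong_antiadj T x y" if "strong_antiadj T y x" for x y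
    using that tri(1) by (auto simp: strong_antiadj_def trigraph_def)
  have xc: "if x \<in> A then strong_adj T x c else strong_antiadj T x c" if "x \<in> ?X" for x
    using c that dj by (auto simp: hp_C_def compl_part_def anti_part_def strongly_complete_def
        strongly_anticomplete_def intro: sym asym)
  have Nc: "if x \<in> ?N Mk_c then strong_adj T x c else strong_antiadj T x c" if "x \<in> ?X" for x
    using xc[OF that] by simp
  have xd: "if x \<in> B then strong_adj T x d else strong_antiadj T x d" if "x \<in> ?X" for x
    using d that dj by (auto simp: hp_D_def compl_part_def anti_part_def strongly_complete_def
        strongly_anticomplete_def intro: sym asym)
  have Nd: "if x \<in> ?N Mk_d then strong_adj T x d else strong_antiadj T x d" if "x \<in> ?X" for x
    using xd[OF that] by simp
  have sA: "strong_adj T x w \<or> strong_antiadj T x w" if "x \<in> ?X" "w \<in> verts T - ?X" for x w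
  proof -
    have "w \<in> compl_part T ?X A \<union> anti_part T ?X A" "w \<in> compl_part T ?X B \<union> anti_part T ?X B"
      using P that by (auto simp: proper_homogeneous_pair_def)
    then show ?thesis using that
      by (auto simp: compl_part_def anti_part_def strongly_complete_def strongly_anticomplete_def
          intro: sym asym)
  qed
  have TH: "trigraph ?H" by (rule trigraph_add_markers[OF tri(1) X]) simp
  have even: "even (length h)" if h: "is_hole ?H h \<or> is_antihole ?H h" for h
  proof (rule ccontr)
    assume odd: "odd (length h)"
    have sub: "set h \<subseteq> Inl ` ?X \<union> {Inr Mk_c, Inr Mk_d}"
      using h by (auto simp: is_hole_def is_antihole_def)
    have "\<not> (Inr Mk_c \<in> set h \<and> Inr Mk_d \<in> set h)"
    proof (cases "is_hole ?H h")
      case True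
      show ?thesis
        by (rule odd_hole_not_both[OF TH True odd])
          (use dj in \<open>auto simp: strong_adj_def strong_antiadj_def split: if_splits\<close>)
    next
      case False
      then have h': "is_hole (complement ?H) h" using h by (simp add: is_antihole_def)
      show ?thesis
        by (rule odd_hole_not_both[OF trigraph_complement[OF TH] h' odd])
          (use dj in \<open>auto simp: strong_adj_def strong_antiadj_def complement_def split: if_splits\<close>)
    qed
    then consider "set h \<subseteq> Inl ` ?X \<union> {Inr Mk_c}" | "set h \<subseteq> Inl ` ?X \<union> {Inr Mk_d}"
      using sub by blast
    then have "even (length h)"
    proof cases
      case 1
      show ?thesis using one_marker_hole_even[OF tri X cd(1) Nc h 1] by blast
    next
      case 2
      show ?thesis using one_marker_hole_even[OF tri X cd(2) Nd h 2] by blast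
    qed
    then show False using odd by simp
  qed
  show ?thesis unfolding block_hp_inside_def
  proof (rule add_markers_class_F[OF T X])
    show "\<not> switchable T x w" if "x \<in> ?X" "w \<in> verts T - ?X" for x w
      using sA[OF that] by (auto simp: strong_adj_def strong_antiadj_def switchable_def)
    \<comment> \<open>This condition and the next are vacuous: each vertex of
      \<open>A \<union> B\<close> sees exactly one of \<open>c\<close> and \<open>d\<close>.\<close>
    show "x \<in> ?N m" if x: "x \<in> ?X" and s: "strongly_complete T x (verts T - ?X)" for x m
    proof -
      have "strong_adj T x c" "strong_adj T x d" using s cd by (auto simp: strongly_complete_def)
      then have "x \<in> A" "x \<in> B" using xc[OF x] xd[OF x]
        by (auto simp: strong_adj_def strong_antiadj_def split: if_splits)
      then show ?thesis using dj by blast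
    qed
    show "x \<notin> ?N m" if x: "x \<in> ?X" and s: "strongly_anticomplete T x (verts T - ?X)" for x m
    proof -
      have "strong_antiadj T x c" "strong_antiadj T x d" using s cd by (auto simp: strongly_anticomplete_def)
      then have "x \<notin> A" "x \<notin> B" using xc[OF x] xd[OF x]
        by (auto simp: strong_adj_def strong_antiadj_def split: if_splits)
      then show ?thesis using x by blast
    qed
    show "?N m = {} \<and> {Mk_c, Mk_d} = {m, p, q} \<and> {p, q} \<notin> {{Mk_c, Mk_d}} \<union> {}"
      if "m \<in> {Mk_c, Mk_d}" "p \<noteq> q" "{n\<in>{Mk_c, Mk_d}. n \<noteq> m \<and> {m, n} \<in> {{Mk_c, Mk_d}}} = {p, q}" for m p q
    proof -
      have "p \<in> {Mk_c, Mk_d} - {m}" "q \<in> {Mk_c, Mk_d} - {m}" using that(3) by blast+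
      then show ?thesis using that(1,2) by auto
    qed
    show "berge ?H" using even unfolding berge_def by blast
  qed auto
qed

section \<open>The outside of a homogeneous pair\<close>

text \<open>Both markers are lifted at once: \<open>a\<close> represents the first, and any vertex
  of \<open>Y\<close> can represent the second. A hole in which the markers are consecutive lifts
  with the neighbour \<open>b\<close>, any other with the antineighbour \<open>b'\<close>.\<close>

lemma lifted_pair_block_berge:
  assumes T: "trigraph T" "berge T" and X: "X \<subseteq> verts T"
    and a: "a \<in> verts T - X" "Y \<subseteq> verts T - X - {a}"
    and b: "b \<in> Y" "adj T a b" and b': "b' \<in> Y" "antiadj T a b'"
    and xa: "\<And>x. x \<in> X \<Longrightarrow> if x \<in> N Mk_a then strong_adj T x a else strong_antiadj T x a"
    and xy: "\<And>x y. x \<in> X \<Longrightarrow> y \<in> Y \<Longrightarrow> if x \<in> N Mk_b then strong_adj T x y else strong_antiadj T x y"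
  shows "berge (add_markers T X {Mk_a, Mk_b} N {{Mk_a, Mk_b}} {})"
proof -
  let ?H = "add_markers T X {Mk_a, Mk_b} N {{Mk_a, Mk_b}} {}"
  define f where "f y = case_sum id (\<lambda>m. if m = Mk_a then a else y)" for y
  have inj: "inj_on (f y) (verts ?H)" and im: "f y ` verts ?H \<subseteq> verts T" if y: "y \<in> Y" for y
  proof -
    have "a \<notin> X" "y \<notin> X" "a \<noteq> y" "a \<in> verts T" "y \<in> verts T" using a y by auto
    then show "inj_on (f y) (verts ?H)" "f y ` verts ?H \<subseteq> verts T" using X
      by (auto simp: inj_on_def f_def)
  qed
  have th: "theta T (f y u) (f y v) = theta ?H u v"
    if y: "y \<in> Y" and uv: "u \<in> verts ?H" "v \<in> verts ?H" "u \<noteq> v" "{u, v} \<noteq> {Inr Mk_a, Inr Mk_b}" for y u v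
  proof -
    have sym: "theta T w x = theta T x w" if "x \<in> X" "w \<in> verts T - X" for x w
      using that T(1) X unfolding trigraph_def by (metis DiffE subsetD)
    have ta: "theta T x a = (if x \<in> N Mk_a then 1 else -1)" "theta T a x = theta T x a" if "x \<in> X" for x
      using xa[OF that] sym[OF that, of a] a
      by (auto simp: strong_adj_def strong_antiadj_def split: if_splits)
    have ty: "theta T x y = (if x \<in> N Mk_b then 1 else -1)" "theta T y x = theta T x y" if "x \<in> X" for x
      using xy[OF that y] sym[OF that, of y] y a(2)
      by (auto simp: strong_adj_def strong_antiadj_def split: if_splits)
    have inX: "x \<in> X" if "Inl x \<in> verts ?H" for x :: 'a
      using that by (simp only: verts_add_markers Un_iff image_iff) auto
    have inM: "m = Mk_a \<or> m = Mk_b" if "Inr m \<in> verts ?H" for m using that by auto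
    show ?thesis
    proof (cases u)
      case (Inl x)
      note u = this
      show ?thesis
      proof (cases v)
        case (Inl y')
        then show ?thesis using u by (simp add: f_def)
      next
        case (Inr m)
        have "x \<in> X" "m = Mk_a \<or> m = Mk_b"
          using inX[of x] inM[of m] uv(1,2) unfolding u Inr by blast+
        then show ?thesis using ta(1)[of x] ty(1)[of x] u Inr by (auto simp: f_def)
      qed
    next
      case (Inr m)
      note u = this
      show ?thesis
      proof (cases v)
        case (Inl x)
        have "x \<in> X" "m = Mk_a \<or> m = Mk_b"
          using inX[of x] inM[of m] uv(1,2) unfolding u Inl by blast+
        then show ?thesis using ta[of x] ty[of x] u Inl by (auto simp: f_def)
      next
        case (Inr n)
        have "m = Mk_a \<or> m = Mk_b" "n = Mk_a \<or> n = Mk_b"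
          using inM[of m] inM[of n] uv(1,2) unfolding u Inr by blast+
        then show ?thesis using uv(3,4) u Inr by (auto simp: insert_commute)
      qed
    qed
  qed
  have fab: "f y (Inr Mk_a) = a" "f y (Inr Mk_b) = y" for y by (auto simp: f_def)
  have even: "even (length h)" if h: "is_hole ?H h" for h
  proof -
    have sub: "set h \<subseteq> verts ?H" using h by (simp add: is_hole_def)
    have "is_hole T (map (f b) h) \<or> is_hole T (map (f b') h)"
    proof (rule hole_map_pair[OF T(1) h, where x = "Inr Mk_a" and y = "Inr Mk_b"])
      show "inj_on (f b) (set h)" "inj_on (f b') (set h)"
        using inj_on_subset[OF inj sub] b b' by auto
      show "f b ` set h \<subseteq> verts T" "f b' ` set h \<subseteq> verts T" using im[OF b(1)] im[OF b'(1)] sub by blast+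
      show "theta T (f b u) (f b v) = theta ?H u v" "theta T (f b' u) (f b' v) = theta ?H u v"
        if "u \<in> set h" "v \<in> set h" "u \<noteq> v" "{u, v} \<noteq> {Inr Mk_a, Inr Mk_b}" for u v
        using th[OF b(1) _ _ that(3,4)] th[OF b'(1) _ _ that(3,4)] that(1,2) sub by blast+
    qed (use b b' in \<open>simp_all add: fab\<close>)
    then show ?thesis using T(2) unfolding berge_def by (metis length_map)
  qed
  have even': "even (length h)" if "is_antihole ?H h" for h
  proof -
    have h: "is_hole (complement ?H) h" using that by (simp add: is_antihole_def)
    then have sub: "set h \<subseteq> verts ?H" by (simp add: is_hole_def)
    \<comment> \<open>In the complement \<open>b'\<close> is adjacent to \<open>a\<close> and
      \<open>b\<close> antiadjacent, so the two maps exchange their roles.\<close>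
    have "is_hole (complement T) (map (f b') h) \<or> is_hole (complement T) (map (f b) h)"
    proof (rule hole_map_pair[OF trigraph_complement[OF T(1)] h, where x = "Inr Mk_a" and y = "Inr Mk_b"])
      show "inj_on (f b) (set h)" "inj_on (f b') (set h)"
        using inj_on_subset[OF inj sub] b b' by auto
      show "f b ` set h \<subseteq> verts (complement T)" "f b' ` set h \<subseteq> verts (complement T)"
        using im[OF b(1)] im[OF b'(1)] sub by (simp_all only: verts_complement) blast+
      show "theta (complement T) (f b u) (f b v) = theta (complement ?H) u v"
        "theta (complement T) (f b' u) (f b' v) = theta (complement ?H) u v"
        if "u \<in> set h" "v \<in> set h" "u \<noteq> v" "{u, v} \<noteq> {Inr Mk_a, Inr Mk_b}" for u v
        using th[OF b(1) _ _ that(3,4)] th[OF b'(1) _ _ that(3,4)] that(1,2) sub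
        by (auto simp: complement_def subset_iff simp del: verts_add_markers theta_add_markers)
    qed (use b b' in \<open>simp_all add: fab\<close>)
    then show ?thesis using T(2) unfolding berge_def is_antihole_def by (metis length_map)
  qed
  show ?thesis using even even' unfolding berge_def by blast
qed

text \<open>Properness gives each vertex of \<open>A\<close> a neighbour and an antineighbour in
  \<open>B\<close>, which is what lifting the switchable pair of markers requires.\<close>

lemma block_hp_outside_class_F:
  assumes T: "T \<in> class_F" and P: "proper_homogeneous_pair T A B"
  shows "block_hp_outside T A B \<in> class_F"
proof -
  let ?X = "hp_C T A B \<union> hp_D T A B \<union> hp_E T A B \<union> hp_F T A B"
  let ?N = "(\<lambda>_. {})(Mk_a := hp_C T A B \<union> hp_E T A B, Mk_b := hp_D T A B \<union> hp_E T A B)"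
  let ?H = "add_markers T ?X {Mk_a, Mk_b} ?N {{Mk_a, Mk_b}} {}"
  have tri: "trigraph T" "berge T" using T by (auto simp: class_F_def)
  have AB: "A \<subseteq> verts T" "B \<subseteq> verts T" "A \<inter> B = {}" "A \<noteq> {}" "B \<noteq> {}"
    using P by (auto simp: proper_homogeneous_pair_def)
  have cover: "verts T - (A \<union> B) = compl_part T (A \<union> B) A \<union> anti_part T (A \<union> B) A"
    "verts T - (A \<union> B) = compl_part T (A \<union> B) B \<union> anti_part T (A \<union> B) B"
    using P by (auto simp: proper_homogeneous_pair_def)
  \<comment> \<open>Each outside vertex is strongly complete or anticomplete to \<open>A\<close>,
    and likewise to \<open>B\<close>; the four combinations are the four parts.\<close>
  have Xeq: "?X = verts T - (A \<union> B)"
    using cover unfolding hp_C_def hp_D_def hp_E_def hp_F_def by blast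
  have X: "?X \<subseteq> verts T" and outer: "verts T - ?X = A \<union> B" using Xeq AB by auto
  have xA: "if x \<in> ?N Mk_a then strong_adj T x a else strong_antiadj T x a" if x: "x \<in> ?X" and a: "a \<in> A" for x a
  proof (cases "x \<in> ?N Mk_a")
    case True
    then show ?thesis using a by (auto simp: hp_C_def hp_E_def compl_part_def strongly_complete_def)
  next
    case False
    then have "x \<in> anti_part T (A \<union> B) A" using x by (auto simp: hp_D_def hp_F_def)
    then show ?thesis using a False by (auto simp: anti_part_def strongly_anticomplete_def)
  qed
  have xB: "if x \<in> ?N Mk_b then strong_adj T x b else strong_antiadj T x b" if x: "x \<in> ?X" and b: "b \<in> B" for x b
  proof (cases "x \<in> ?N Mk_b")
    case True
    then show ?thesis using b by (auto simp: hp_D_def hp_E_def compl_part_def strongly_complete_def)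
  next
    case False
    then have "x \<in> anti_part T (A \<union> B) B" using x by (auto simp: hp_C_def hp_F_def)
    then show ?thesis using b False by (auto simp: anti_part_def strongly_anticomplete_def)
  qed
  obtain a where a: "a \<in> A" using AB(4) by blast
  have "(\<exists>b\<in>B. adj T a b) \<and> (\<exists>b\<in>B. antiadj T a b)"
    using P a by (simp add: proper_homogeneous_pair_def)
  then obtain b b' where b: "b \<in> B" "adj T a b" and b': "b' \<in> B" "antiadj T a b'" by blast
  have berge: "berge ?H"
  proof (rule lifted_pair_block_berge[OF tri X _ _ b b'])
    show "a \<in> verts T - ?X" "B \<subseteq> verts T - ?X - {a}" using outer a AB by auto
  qed (rule xA[OF _ a] xB; assumption)+
  show ?thesis unfolding block_hp_outside_def
  proof (rule add_markers_class_F[OF T X])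
    show "\<not> switchable T x w" if "x \<in> ?X" "w \<in> verts T - ?X" for x w
      using xA[OF that(1), of w] xB[OF that(1), of w] that(2) outer
      by (auto simp: strong_adj_def strong_antiadj_def switchable_def split: if_splits)
    \<comment> \<open>Unlike for the inside block, such vertices exist: those of
      \<open>hp_E\<close>, which see both markers. Dually, those of \<open>hp_F\<close> see
      neither.\<close>
    show "x \<in> ?N m" if x: "x \<in> ?X" and s: "strongly_complete T x (verts T - ?X)" and m: "m \<in> {Mk_a, Mk_b}" for x m
    proof -
      have "strong_adj T x a" "strong_adj T x b" using s a b outer by (auto simp: strongly_complete_def)
      then have "x \<in> ?N Mk_a" "x \<in> ?N Mk_b" using xA[OF x a] xB[OF x b(1)]
        by (simp_all add: strong_adj_def strong_antiadj_def split: if_splits)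
      then show ?thesis using m by auto
    qed
    show "x \<notin> ?N m" if x: "x \<in> ?X" and s: "strongly_anticomplete T x (verts T - ?X)" and m: "m \<in> {Mk_a, Mk_b}" for x m
    proof -
      have "strong_antiadj T x a" "strong_antiadj T x b" using s a b outer by (auto simp: strongly_anticomplete_def)
      then have "x \<notin> ?N Mk_a" "x \<notin> ?N Mk_b" using xA[OF x a] xB[OF x b(1)]
        by (simp_all add: strong_adj_def strong_antiadj_def split: if_splits)
      then show ?thesis using m by auto
    qed
    show "?N m = {} \<and> {Mk_a, Mk_b} = {m, p, q} \<and> {p, q} \<notin> {{Mk_a, Mk_b}} \<union> {}"
      if "m \<in> {Mk_a, Mk_b}" "p \<noteq> q" "{n\<in>{Mk_a, Mk_b}. n \<noteq> m \<and> {m, n} \<in> {{Mk_a, Mk_b}}} = {p, q}" for m p q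
    proof -
      have "p \<in> {Mk_a, Mk_b} - {m}" "q \<in> {Mk_a, Mk_b} - {m}" using that(3) by blast+
      then show ?thesis using that(1,2) by auto
    qed
    show "berge ?H" by (rule berge)
  qed auto
qed

section \<open>The six kinds of blocks\<close>

theorem theorem9p1:
  fixes T :: "'a trigraph" and X :: "'a set" and TX :: "('a + marker) trigraph"
  assumes "T \<in> class_F"
    and "\<nexists>A B. balanced_skew_partition T A B"
    and "fragment T X"
    and "is_block T X TX"
  shows "TX \<in> class_F"
  using assms(4)
proof cases
  case (odd_two_join A1 B1 C1 A2 B2 C2)
  then show ?thesis using two_join_block_class_F[OF assms(1), where P = True]
    by (auto simp: proper_two_join_def odd_split_def)
next
  case (even_two_join A1 B1 C1 A2 B2 C2)
  then show ?thesis using two_join_block_class_F[OF assms(1), where P = False]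
    by (auto simp: proper_two_join_def even_split_def)
next
  case (odd_complement_two_join A1 B1 C1 A2 B2 C2)
  then show ?thesis using complement_two_join_block_class_F[OF assms(1), where P = True]
    by (auto simp: proper_complement_two_join_def proper_two_join_def odd_split_def)
next
  case (even_complement_two_join A1 B1 C1 A2 B2 C2)
  then show ?thesis using complement_two_join_block_class_F[OF assms(1), where P = False]
    by (auto simp: proper_complement_two_join_def proper_two_join_def even_split_def)
next
  case (hp_inside A B)
  then show ?thesis using block_hp_inside_class_F[OF assms(1)] by simp
next
  case (hp_outside A B)
  then show ?thesis using block_hp_outside_class_F[OF assms(1)] by simp
qed

end
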